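(* Let $n\ge 2$ and let $E,E'$ be strongly independent equations in the unknowns $x_1,\dots,x_n$. Let $m$ be a number such that there exist $m$ common solutions of $E$ and $E'$ of rank $n-1$ which are pairwise linearly nonequivalent. Then (1) $m\le |E|+|E'|$; (2) there exist indices $1\le k<\ell\le n$ such that $m\le 2(|E|_{x_k}+|E|_{x_\ell})$.
   Context: Unknowns $\Xi=\{x_1,\dots,x_n\}$. An equation is a pair $E=(u,v)$ of words over $\Xi$; $|E|=|u|+|v|$ and $|E|_{x}=|u|_x+|v|_x$, where $|w|_x$ counts occurrences of $x$ in $w$. A solution of an equation $(u,v)$ is a monoid morphism $h:\Xi^*\to\{a_1,\dots,a_k\}^*$ with $h(u)=h(v)$. For such $h$ let $\gamma(h)_i=(|h(x_1)|_{a_i},\dots,|h(x_n)|_{a_i})\in\mathbb Q^n$, let $\Gamma_h$ be the $\mathbb Q$-span of $\gamma(h)_1,\dots,\gamma(h)_k$; the rank of $h$ is $\dim\Gamma_h$. Morphisms $h,h'$ are linearly equivalent if $\Gamma_h=\Gamma_{h'}$. Two equations $E,E'$ in $n$ unknowns are strongly independent if the system $\{E,E'\}$ is strongly independent, i.e. $E$ has a solution of rank $n-1$ that is not a solution of $E'$, and $E'$ has a solution of rank $n-1$ that is not a solution of $E$. *)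

theory Defs
  imports Complex_Main "HOL-Library.Function_Algebras"
begin

text \<open>Unknowns are the elements of a finite type 'x (so n = CARD('x)); letters of the
  target alphabet are elements of a type 'a. A morphism h from the free monoid over the
  unknowns is given by the images h x of the unknowns.\<close>

type_synonym ('x, 'a) morph = "'x \<Rightarrow> 'a list"
type_synonym 'x equation = "'x list \<times> 'x list"

definition apply_morph :: "('x, 'a) morph \<Rightarrow> 'x list \<Rightarrow> 'a list" where
  "apply_morph h w = concat (map h w)"

definition is_solution :: "'x equation \<Rightarrow> ('x, 'a) morph \<Rightarrow> bool" where
  "is_solution E h \<longleftrightarrow> apply_morph h (fst E) = apply_morph h (snd E)"

definition eq_length :: "'x equation \<Rightarrow> nat" where
  "eq_length E = length (fst E) + length (snd E)"

definition eq_count :: "'x equation \<Rightarrow> 'x \<Rightarrow> nat" where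
  "eq_count E x = count_list (fst E) x + count_list (snd E) x"

definition qsmul :: "rat \<Rightarrow> ('x \<Rightarrow> rat) \<Rightarrow> ('x \<Rightarrow> rat)" where
  "qsmul c v = (\<lambda>i. c * v i)"

lemma vector_space_qsmul: "vector_space qsmul"
  by unfold_locales (auto simp: qsmul_def algebra_simps)

definition gamma :: "('x, 'a) morph \<Rightarrow> 'a \<Rightarrow> ('x \<Rightarrow> rat)" where
  "gamma h a = (\<lambda>x. of_nat (count_list (h x) a))"

definition Gamma :: "('x, 'a) morph \<Rightarrow> ('x \<Rightarrow> rat) set" where
  "Gamma h = module.span qsmul (range (gamma h))"

definition morph_rank :: "('x, 'a) morph \<Rightarrow> nat" where
  "morph_rank h = vector_space.dim qsmul (Gamma h)"

definition lin_equiv :: "('x, 'a) morph \<Rightarrow> ('x, 'a) morph \<Rightarrow> bool" where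
  "lin_equiv h h' \<longleftrightarrow> Gamma h = Gamma h'"

text \<open>Letters of witness solutions are taken from nat; every finite alphabet
  {a_1,...,a_k} embeds into nat, so this loses no generality.\<close>
definition strongly_independent :: "('x::finite) equation \<Rightarrow> 'x equation \<Rightarrow> bool" where
  "strongly_independent E E' \<longleftrightarrow>
     (\<exists>h :: ('x, nat) morph. is_solution E h \<and> morph_rank h = card (UNIV :: 'x set) - 1 \<and> \<not> is_solution E' h) \<and>
     (\<exists>h :: ('x, nat) morph. is_solution E' h \<and> morph_rank h = card (UNIV :: 'x set) - 1 \<and> \<not> is_solution E h)"

end

theory Submission
  imports Defs "HOL-Analysis.Analysis"
begin

text \<open>
  For an equation \<open>E = (u, v)\<close> and an unknown \<open>k\<close> let \<open>T\<^sub>k(\<theta>)\<close> be the sum of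
  \<open>exp (\<theta> \<bullet> p)\<close> over the Parikh vectors \<open>p\<close> of the prefixes of \<open>u\<close> that precede an occurrence of
  \<open>k\<close>, minus the same sum for \<open>v\<close>. If a solution \<open>h\<close> has rank \<open>n - 1\<close>, then for \<open>\<theta>\<close> in the real
  hyperplane spanned by its Parikh vectors and close to 0, the vector \<open>T(\<theta>)\<close> is orthogonal to \<open>n - 1\<close>
  independent vectors. Hence for two equations solved by \<open>h\<close> every minor
  \<open>D = T\<^sub>k T'\<^sub>l - T\<^sub>l T'\<^sub>k\<close> vanishes on that hyperplane, whereas strong independence makes some
  minor nonzero.

  The exponents of \<open>D\<close> are covered by \<open>2 (|E|\<^sub>k + |E|\<^sub>l)\<close> chains: fix an occurrence of \<open>k\<close> or \<open>l\<close> in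
  \<open>E\<close> and a side of \<open>E'\<close>, and let the occurrence of the other unknown on this side vary. For positive
  \<open>w\<close> consider the exponents of \<open>D\<close> of lowest weight. A chain contains at most one exponent that is
  the unique lowest one for some \<open>w\<close>; such an exponent determines the side of each hyperplane
  on which \<open>w\<close> lies, since no lowest exponent is unique on a hyperplane; and \<open>r\<close> distinct hyperplanes
  that meet the cone of the \<open>w\<close> cut it into at least \<open>r + 1\<close> parts. So \<open>r + 1 \<le> 2 (|E|\<^sub>k + |E|\<^sub>l)\<close>. The
  hyperplanes of solutions that erase \<open>k\<close> or \<open>l\<close> do not meet the cone, but with a proper choice of
  \<open>k\<close> and \<open>l\<close> there is at most one of them. Exchanging \<open>E\<close> and \<open>E'\<close> and adding the two bounds gives
  (1).
\<close>

section \<open>Exponential sums\<close>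

text \<open>A Vandermonde argument: samples at equidistant points of the interval are power moments
  of the distinct nodes \<open>y \<rho>\<close>, and a polynomial that vanishes at all nodes but one
  isolates the coefficient of that one.\<close>

lemma exp_sum_eq_0_interval:
  fixes r s :: "'i \<Rightarrow> real"
  assumes "finite I" "a < b"
    and zero: "\<And>t. a < t \<Longrightarrow> t < b \<Longrightarrow> (\<Sum>i\<in>I. s i * exp (t * r i)) = 0"
  shows "(\<Sum>i\<in>{i\<in>I. r i = \<rho>}. s i) = 0"
proof (cases "\<rho> \<in> r ` I")
  case False
  then have "{i\<in>I. r i = \<rho>} = {}" by auto
  then show ?thesis by (simp only: sum.empty)
next
  case True
  define R where "R = r ` I"
  have fR: "finite R" using assms by (simp add: R_def)
  define N where "N = card R + 1"
  \<comment> \<open>With this step width and a start half a step after \<open>a\<close>, all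
    \<open>N\<close> sample points lie strictly inside the interval.\<close>
  define d where "d = (b - a) / (real N + 1)"
  have d: "d > 0" using assms by (simp add: d_def)
  define t0 where "t0 = a + d / 2"
  define y where "y = (\<lambda>\<rho>::real. exp (d * \<rho>))"
  define c where "c = (\<lambda>\<rho>. (\<Sum>i\<in>{i\<in>I. r i = \<rho>}. s i) * exp (t0 * \<rho>))"
  have mom: "(\<Sum>\<rho>\<in>R. c \<rho> * y \<rho> ^ j) = 0" if j: "j < N" for j
  proof -
    have "real j * d + d / 2 < (real N + 1) * d"
    proof -
      have "(real j + 1/2) * d < (real N + 1) * d"
        using j d by (intro mult_strict_right_mono) auto
      then show ?thesis by (simp add: algebra_simps)
    qed
    also have "\<dots> = b - a" by (simp add: d_def)
    finally have "(\<Sum>i\<in>I. s i * exp ((t0 + real j * d) * r i)) = 0"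
      using d by (intro zero) (auto simp: t0_def intro: add_pos_nonneg)
    also have "(\<Sum>i\<in>I. s i * exp ((t0 + real j * d) * r i))
        = (\<Sum>\<rho>\<in>R. \<Sum>i\<in>{i\<in>I. r i = \<rho>}. s i * exp ((t0 + real j * d) * r i))"
      unfolding R_def by (rule sum.image_gen[OF \<open>finite I\<close>])
    also have "\<dots> = (\<Sum>\<rho>\<in>R. c \<rho> * y \<rho> ^ j)"
    proof (intro sum.cong refl)
      fix \<rho>
      have "exp ((t0 + real j * d) * \<rho>) = exp (t0 * \<rho>) * y \<rho> ^ j"
        by (simp add: y_def exp_of_nat_mult[symmetric] exp_add[symmetric] algebra_simps)
      then show "(\<Sum>i\<in>{i\<in>I. r i = \<rho>}. s i * exp ((t0 + real j * d) * r i)) = c \<rho> * y \<rho> ^ j"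
        by (simp add: c_def sum_distrib_right mult.assoc)
    qed
    finally show ?thesis .
  qed
  have polyz: "(\<Sum>\<rho>\<in>R. c \<rho> * poly q (y \<rho>)) = 0" if q: "degree q < N" for q
  proof -
    have "(\<Sum>\<rho>\<in>R. c \<rho> * poly q (y \<rho>)) = (\<Sum>\<rho>\<in>R. \<Sum>j\<le>degree q. coeff q j * (c \<rho> * y \<rho> ^ j))"
      by (simp add: poly_altdef sum_distrib_left algebra_simps)
    also have "\<dots> = (\<Sum>j\<le>degree q. coeff q j * (\<Sum>\<rho>\<in>R. c \<rho> * y \<rho> ^ j))"
      by (subst sum.swap) (simp add: sum_distrib_left)
    also have "\<dots> = 0" using mom q by simp
    finally show ?thesis .
  qed
  define q where "q = (\<Prod>\<sigma>\<in>R - {\<rho>}. [:- y \<sigma>, 1:])"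
  have "degree q \<le> (\<Sum>\<sigma>\<in>R - {\<rho>}. degree [:- y \<sigma>, 1:])"
    unfolding q_def using degree_prod_sum_le[of "R - {\<rho>}" "\<lambda>\<sigma>. [:- y \<sigma>, 1:]"] fR by (simp add: o_def)
  also have "\<dots> = card (R - {\<rho>})" by simp
  also have "\<dots> < N" using fR by (auto simp: N_def card_Diff_subset_Int intro: le_imp_less_Suc card_mono)
  finally have "(\<Sum>\<sigma>\<in>R. c \<sigma> * poly q (y \<sigma>)) = 0" by (rule polyz)
  moreover have "(\<Sum>\<sigma>\<in>R. c \<sigma> * poly q (y \<sigma>)) = (\<Sum>\<sigma>\<in>{\<rho>}. c \<sigma> * poly q (y \<sigma>))"
  proof (rule sum.mono_neutral_right[OF fR])
    show "{\<rho>} \<subseteq> R" using True by (simp add: R_def)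
    show "\<forall>\<sigma>\<in>R - {\<rho>}. c \<sigma> * poly q (y \<sigma>) = 0"
      using fR by (auto simp: q_def poly_prod intro!: prod_zero)
  qed
  moreover have "poly q (y \<rho>) \<noteq> 0"
    using fR d by (auto simp: q_def poly_prod y_def)
  ultimately show ?thesis by (simp add: c_def)
qed

lemma exp_sum_extend:
  fixes r s :: "'i \<Rightarrow> real"
  assumes "finite I" "a < b"
    and "\<And>t. a < t \<Longrightarrow> t < b \<Longrightarrow> (\<Sum>i\<in>I. s i * exp (t * r i)) = 0"
  shows "(\<Sum>i\<in>I. s i * exp (t * r i)) = 0"
proof -
  have "(\<Sum>i\<in>I. s i * exp (t * r i)) = (\<Sum>\<rho>\<in>r ` I. \<Sum>i\<in>{i\<in>I. r i = \<rho>}. s i * exp (t * r i))"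
    by (rule sum.image_gen[OF \<open>finite I\<close>])
  also have "\<dots> = (\<Sum>\<rho>\<in>r ` I. (\<Sum>i\<in>{i\<in>I. r i = \<rho>}. s i) * exp (t * \<rho>))"
    by (intro sum.cong refl) (simp add: sum_distrib_right)
  also have "\<dots> = 0" using exp_sum_eq_0_interval[OF assms] by simp
  finally show ?thesis .
qed

section \<open>Generic points and sign patterns of hyperplanes\<close>

text \<open>The hyperplanes are left one after another: a small step along \<open>d\<close> leaves
  the new one, and openness preserves what was reached before. \<open>V\<close> is the whole space
  or, to find a point of one hyperplane off the others, that hyperplane.\<close>

lemma perturb_off_hyperplanes:
  fixes V :: "'v::euclidean_space set"
  assumes V: "subspace V" and "finite N" "open U" "base \<in> U" "base \<in> V"
    and "\<And>v. v \<in> N \<Longrightarrow> \<exists>d\<in>V. v \<bullet> d \<noteq> 0"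
  shows "\<exists>w\<in>U \<inter> V. \<forall>v\<in>N. v \<bullet> w \<noteq> 0"
  using assms(2,6)
proof (induction N rule: finite_induct)
  case empty
  then show ?case using assms by auto
next
  case (insert v N)
  then obtain w where w: "w \<in> U" "w \<in> V" "\<forall>v\<in>N. v \<bullet> w \<noteq> 0" by auto
  obtain d where d: "d \<in> V" "v \<bullet> d \<noteq> 0" using insert.prems by auto
  show ?case
  proof (cases "v \<bullet> w = 0")
    case False
    then show ?thesis using w by auto
  next
    case True
    define O' where "O' = U \<inter> (\<Inter>v\<in>N. {x. v \<bullet> x \<noteq> 0})"
    have "open {x. v \<bullet> x \<noteq> 0}" for v :: 'v
      by (intro open_Collect_neq continuous_intros)
    then have "open O'" using \<open>open U\<close> \<open>finite N\<close> by (auto simp: O'_def)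
    moreover have "w \<in> O'" using w by (auto simp: O'_def)
    moreover have "((\<lambda>\<eta>. w + \<eta> *\<^sub>R d) \<longlongrightarrow> w + 0 *\<^sub>R d) (at_right 0)"
      by (intro tendsto_intros)
    ultimately have "\<forall>\<^sub>F \<eta> in at_right 0. w + \<eta> *\<^sub>R d \<in> O'"
      by (auto dest: topological_tendstoD)
    moreover have "\<forall>\<^sub>F \<eta> in at_right (0::real). \<eta> > 0" by (simp add: eventually_at_right_less)
    ultimately have "\<forall>\<^sub>F \<eta> in at_right (0::real). w + \<eta> *\<^sub>R d \<in> O' \<and> \<eta> > 0"
      by eventually_elim simp
    then obtain \<eta> where \<eta>: "w + \<eta> *\<^sub>R d \<in> O'" "\<eta> > (0::real)"
      using eventually_happens trivial_limit_at_right_real by blast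
    moreover have "w + \<eta> *\<^sub>R d \<in> V" using V w d by (simp add: subspace_add subspace_scale)
    moreover have "v \<bullet> (w + \<eta> *\<^sub>R d) \<noteq> 0" using True d \<eta> by (simp add: inner_add_right)
    ultimately show ?thesis by (auto simp: O'_def)
  qed
qed

text \<open>Forgetting the coordinate \<open>i\<close> identifies \<open>A\<close> and \<open>insert i A\<close>, so every coordinate adds a pattern.\<close>

lemma card_sign_patterns:
  assumes "finite I"
    and flip: "\<And>i. i \<in> I \<Longrightarrow> \<exists>A. A \<in> S \<and> insert i A \<in> S \<and> i \<notin> A"
    and sub: "\<And>A. A \<in> S \<Longrightarrow> A \<subseteq> I" and ne: "S \<noteq> {}"
  shows "card I + 1 \<le> card S"
  using assms
proof (induction I arbitrary: S rule: finite_induct)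
  case empty
  then have "S = {{}}" by auto
  then show ?case by simp
next
  case (insert i I)
  define S' where "S' = (\<lambda>A. A - {i}) ` S"
  have fS: "finite S"
    by (rule finite_subset[of _ "Pow (insert i I)"]) (use insert in auto)
  have "card I + 1 \<le> card S'"
  proof (rule insert.IH)
    fix j assume j: "j \<in> I"
    then obtain A where A: "A \<in> S" "insert j A \<in> S" "j \<notin> A" using insert.prems(1) by blast
    have "insert j A - {i} = insert j (A - {i})" using j insert.hyps by auto
    then have "A - {i} \<in> S'" "insert j (A - {i}) \<in> S'" "j \<notin> A - {i}"
      using A unfolding S'_def by (auto simp del: insert_Diff_single intro: image_eqI)
    then show "\<exists>A. A \<in> S' \<and> insert j A \<in> S' \<and> j \<notin> A" by blast
  next
    fix A assume "A \<in> S'"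
    then show "A \<subseteq> I" using insert.prems(2) by (auto simp: S'_def)
  next
    show "S' \<noteq> {}" using insert.prems by (simp add: S'_def)
  qed
  moreover have "card S' < card S"
  proof -
    obtain A where A: "A \<in> S" "insert i A \<in> S" "i \<notin> A" using insert.prems(1) by blast
    moreover have "A - {i} = insert i A - {i}" by simp
    ultimately have "\<not> inj_on (\<lambda>A. A - {i}) S" by (metis inj_onD insertI1)
    then show ?thesis
      unfolding S'_def using fS by (metis card_image_le eq_card_imp_inj_on le_neq_implies_less)
  qed
  ultimately show ?case using insert.hyps by simp
qed

text \<open>The component of \<open>v\<close> orthogonal to \<open>l\<close> is a witness; it is
  nonzero because \<open>v\<close> is no multiple of \<open>l\<close>.\<close>

lemma hyperplane_not_in_hyperplane:
  fixes v l :: "'v::euclidean_space"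
  assumes "l \<noteq> 0" "\<And>c. v \<noteq> c *\<^sub>R l"
  shows "\<exists>d\<in>{d. l \<bullet> d = 0}. v \<bullet> d \<noteq> 0"
proof
  define d where "d = v - ((v \<bullet> l) / (l \<bullet> l)) *\<^sub>R l"
  have ld: "l \<bullet> d = 0" using assms(1) by (simp add: d_def inner_diff_right inner_commute)
  then show "d \<in> {d. l \<bullet> d = 0}" by simp
  have "d \<noteq> 0" using assms(2) by (simp add: d_def)
  moreover have "v \<bullet> d = d \<bullet> d"
    using ld by (simp add: d_def inner_diff_left inner_diff_right inner_commute algebra_simps)
  ultimately show "v \<bullet> d \<noteq> 0" by simp
qed

text \<open>The sign pattern of a generic point of \<open>C\<close> is sent to the class of a term
  whose exponent is lowest there. This is injective: \<open>chain\<close> forbids two different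
  lowest exponents in one class, and the points of \<open>C\<close> with the same lowest exponent
  form a convex set that meets no hyperplane.\<close>

lemma exponential_sum_hyperplane_count:
  fixes e :: "'i \<Rightarrow> 'v::euclidean_space" and s :: "'i \<Rightarrow> real" and cls :: "'i \<Rightarrow> 'c"
    and l :: "'j \<Rightarrow> 'v"
  assumes fin: "finite X" "finite K" "finite I"
    and cls: "cls ` X \<subseteq> K"
    and C: "open C" "convex C" "C \<noteq> {}"
    and chain: "\<And>x y. x \<in> X \<Longrightarrow> y \<in> X \<Longrightarrow> cls x = cls y \<Longrightarrow> e x \<noteq> e y \<Longrightarrow>
        (\<forall>w\<in>C. w \<bullet> e x < w \<bullet> e y) \<or> (\<forall>w\<in>C. w \<bullet> e y < w \<bullet> e x)"
    and nz: "(\<Sum>x\<in>X. s x * exp (\<theta> \<bullet> e x)) \<noteq> 0"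
    and l0: "\<And>i. i \<in> I \<Longrightarrow> l i \<noteq> 0"
    and lpar: "\<And>i j c. i \<in> I \<Longrightarrow> j \<in> I \<Longrightarrow> i \<noteq> j \<Longrightarrow> l j \<noteq> c *\<^sub>R l i"
    and meet: "\<And>i. i \<in> I \<Longrightarrow> \<exists>w\<in>C. l i \<bullet> w = 0"
    and vanish: "\<And>i w. i \<in> I \<Longrightarrow> w \<in> C \<Longrightarrow> l i \<bullet> w = 0 \<Longrightarrow>
        \<exists>\<delta>>0. \<forall>t. 0 < t \<and> t < \<delta> \<longrightarrow> (\<Sum>x\<in>X. s x * exp (t * (w \<bullet> e x))) = 0"
  shows "card I + 1 \<le> card K"
proof -
  \<comment> \<open>\<open>c\<close> collects the terms with equal exponent, and \<open>S\<close>
    keeps the exponents that do not cancel.\<close>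
  define c where "c = (\<lambda>p. \<Sum>x\<in>{x\<in>X. e x = p}. s x)"
  define S where "S = {p \<in> e ` X. c p \<noteq> 0}"
  have fS: "finite S" using fin by (simp add: S_def)
  have sumS: "(\<Sum>x\<in>X. s x * f (e x)) = (\<Sum>p\<in>S. c p * f p)" for f :: "'v \<Rightarrow> real"
  proof -
    have "(\<Sum>x\<in>X. s x * f (e x)) = (\<Sum>p\<in>e ` X. \<Sum>x\<in>{x\<in>X. e x = p}. s x * f (e x))"
      by (rule sum.image_gen[OF fin(1)])
    also have "\<dots> = (\<Sum>p\<in>e ` X. c p * f p)"
      by (intro sum.cong refl) (simp add: c_def sum_distrib_right)
    also have "\<dots> = (\<Sum>p\<in>S. c p * f p)"
      using fin by (intro sum.mono_neutral_right) (auto simp: S_def)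
    finally show ?thesis .
  qed
  have "S \<noteq> {}" using nz sumS[of "\<lambda>p. exp (\<theta> \<bullet> p)"] by auto
  define lowest where "lowest = (\<lambda>w p. p \<in> S \<and> (\<forall>q\<in>S - {p}. w \<bullet> p < w \<bullet> q))"
  \<comment> \<open>Along the ray through \<open>w\<close> a unique lowest exponent \<open>p\<close>
    would be the only one with its frequency, which would force \<open>c p = 0\<close>.\<close>
  have no_lowest: "\<not> lowest w p" if i: "i \<in> I" and w: "w \<in> C" "l i \<bullet> w = 0" for i w p
  proof
    assume low: "lowest w p"
    obtain \<delta> where \<delta>: "\<delta> > 0" "\<And>t. 0 < t \<Longrightarrow> t < \<delta> \<Longrightarrow> (\<Sum>x\<in>X. s x * exp (t * (w \<bullet> e x))) = 0"
      using vanish[OF i w] by auto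
    have "(\<Sum>q\<in>{q\<in>S. w \<bullet> q = w \<bullet> p}. c q) = 0"
    proof (rule exp_sum_eq_0_interval[OF fS \<open>\<delta> > 0\<close>])
      fix t assume "0 < t" "t < \<delta>"
      then show "(\<Sum>q\<in>S. c q * exp (t * (w \<bullet> q))) = 0"
        using \<delta>(2) sumS[of "\<lambda>p. exp (t * (w \<bullet> p))"] by simp
    qed
    moreover have "q = p" if "q \<in> S" "w \<bullet> q = w \<bullet> p" for q
      using low that unfolding lowest_def by (metis DiffI less_irrefl singletonD)
    then have "{q\<in>S. w \<bullet> q = w \<bullet> p} = {p}" using low unfolding lowest_def by auto
    ultimately show False using low by (simp add: lowest_def S_def)
  qed
  \<comment> \<open>Off the zero sets of the differences the lowest exponent is unique; off those of
    the \<open>l i\<close> every sign is definite.\<close>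
  define N where "N = {p - q | p q. p \<in> S \<and> q \<in> S \<and> p \<noteq> q} \<union> l ` I"
  have fN: "finite N"
  proof -
    have "{p - q | p q. p \<in> S \<and> q \<in> S \<and> p \<noteq> q} \<subseteq> (\<lambda>(p,q). p - q) ` (S \<times> S)" by auto
    then have "finite {p - q | p q. p \<in> S \<and> q \<in> S \<and> p \<noteq> q}"
      by (rule finite_subset) (use fS in simp)
    then show ?thesis using fin by (simp add: N_def)
  qed
  have N0: "0 \<notin> N" using l0 by (auto simp: N_def)
  define G where "G = {w \<in> C. \<forall>v\<in>N. v \<bullet> w \<noteq> 0}"
  have G_open: "\<exists>w. w \<in> G \<and> w \<in> U" if U: "open U" "U \<inter> C \<noteq> {}" for U
  proof -
    obtain base where "base \<in> U \<inter> C" using U by auto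
    moreover have "\<exists>d\<in>UNIV. v \<bullet> d \<noteq> 0" if "v \<in> N" for v
      using that N0 by (intro bexI[of _ v]) auto
    ultimately have "\<exists>w\<in>(U \<inter> C) \<inter> UNIV. \<forall>v\<in>N. v \<bullet> w \<noteq> 0"
      using U C fN by (intro perturb_off_hyperplanes[where base = base]) auto
    then show ?thesis by (auto simp: G_def)
  qed
  have ex_low: "\<exists>p. lowest w p" if "w \<in> G" for w
  proof -
    have "finite ((\<lambda>p. w \<bullet> p) ` S)" "(\<lambda>p. w \<bullet> p) ` S \<noteq> {}" using fS \<open>S \<noteq> {}\<close> by auto
    from Min_in[OF this] obtain p where p: "p \<in> S" "w \<bullet> p = Min ((\<lambda>p. w \<bullet> p) ` S)" by auto
    have "w \<bullet> p < w \<bullet> q" if q: "q \<in> S - {p}" for q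
    proof -
      have "w \<bullet> p \<le> w \<bullet> q" using q p fS by simp
      moreover have "p - q \<in> N" using p q by (auto simp: N_def)
      then have "(p - q) \<bullet> w \<noteq> 0" using \<open>w \<in> G\<close> unfolding G_def by blast
      then have "w \<bullet> p \<noteq> w \<bullet> q" using inner_diff_left[of p q w] by (metis inner_commute right_minus_eq)
      ultimately show ?thesis by simp
    qed
    then show ?thesis unfolding lowest_def using p(1) by blast
  qed
  define sg where "sg = (\<lambda>w. {i\<in>I. l i \<bullet> w > 0})"
  have pats: "card I + 1 \<le> card (sg ` G)"
  proof (rule card_sign_patterns[OF fin(3)])
    fix i assume i: "i \<in> I"
    obtain base where base: "base \<in> C" "l i \<bullet> base = 0" using meet[OF i] by auto
    \<comment> \<open>From a point of hyperplane \<open>i\<close> that lies on no other one, small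
      steps to both sides change the sign of \<open>l i\<close> only.\<close>
    have "\<exists>w\<in>C \<inter> {d. l i \<bullet> d = 0}. \<forall>v\<in>l ` (I - {i}). v \<bullet> w \<noteq> 0"
    proof (rule perturb_off_hyperplanes[where base = base])
      show "subspace {d. l i \<bullet> d = 0}" by (rule subspace_hyperplane)
      fix v assume "v \<in> l ` (I - {i})"
      then show "\<exists>d\<in>{d. l i \<bullet> d = 0}. v \<bullet> d \<noteq> 0"
        using l0[OF i] lpar[OF i] by (intro hyperplane_not_in_hyperplane) auto
    qed (use C base fin in auto)
    then obtain w where w: "w \<in> C" "l i \<bullet> w = 0" "\<And>j. j \<in> I - {i} \<Longrightarrow> l j \<bullet> w \<noteq> 0" by auto
    define U where "U = {x. \<forall>j\<in>I - {i}. (l j \<bullet> w) * (l j \<bullet> x) > 0}"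
    have "U = (\<Inter>j\<in>I - {i}. {x. (l j \<bullet> w) * (l j \<bullet> x) > 0})" by (auto simp: U_def)
    moreover have "open {x. (l j \<bullet> w) * (l j \<bullet> x) > 0}" for j
      by (intro open_Collect_less continuous_intros)
    ultimately have oU: "open U" using fin by auto
    have wU: "w \<in> U" unfolding U_def using w(3) not_real_square_gt_zero by blast
    have half: "\<exists>x\<in>G. x \<in> U \<and> \<epsilon> * (l i \<bullet> x) > 0" if \<epsilon>: "\<epsilon> = 1 \<or> \<epsilon> = -1" for \<epsilon> :: real
    proof -
      have "((\<lambda>\<eta>. w + \<eta> *\<^sub>R (\<epsilon> *\<^sub>R l i)) \<longlongrightarrow> w + 0 *\<^sub>R (\<epsilon> *\<^sub>R l i)) (at_right 0)"
        by (intro tendsto_intros)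
      then have "\<forall>\<^sub>F \<eta> in at_right 0. w + \<eta> *\<^sub>R (\<epsilon> *\<^sub>R l i) \<in> U \<inter> C"
        using oU C wU w by (intro topological_tendstoD) auto
      moreover have "\<forall>\<^sub>F \<eta> in at_right (0::real). \<eta> > 0" by (simp add: eventually_at_right_less)
      ultimately have "\<forall>\<^sub>F \<eta> in at_right (0::real). w + \<eta> *\<^sub>R (\<epsilon> *\<^sub>R l i) \<in> U \<inter> C \<and> \<eta> > 0"
        by eventually_elim simp
      then obtain \<eta> where \<eta>: "w + \<eta> *\<^sub>R (\<epsilon> *\<^sub>R l i) \<in> U \<inter> C" "\<eta> > (0::real)"
        using eventually_happens trivial_limit_at_right_real by blast
      have "l i \<bullet> l i > 0" using l0[OF i] by simp
      then have "\<epsilon> * (l i \<bullet> (w + \<eta> *\<^sub>R (\<epsilon> *\<^sub>R l i))) > 0"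
        using w \<eta> \<epsilon> by (auto simp: inner_add_right)
      then have "(U \<inter> {x. \<epsilon> * (l i \<bullet> x) > 0}) \<inter> C \<noteq> {}" using \<eta> by auto
      moreover have "open (U \<inter> {x. \<epsilon> * (l i \<bullet> x) > 0})"
        by (intro open_Int oU open_Collect_less continuous_intros)
      ultimately show ?thesis using G_open[of "U \<inter> {x. \<epsilon> * (l i \<bullet> x) > 0}"] by auto
    qed
    obtain x1 x2 where x: "x1 \<in> G" "x1 \<in> U" "l i \<bullet> x1 > 0" "x2 \<in> G" "x2 \<in> U" "l i \<bullet> x2 < 0"
      using half[of 1] half[of "-1"] by auto
    have same: "l j \<bullet> x1 > 0 \<longleftrightarrow> l j \<bullet> x2 > 0" if "j \<in> I - {i}" for j
      using x that by (auto simp: U_def zero_less_mult_iff dest!: bspec[where x = j])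
    have "sg x1 = insert i (sg x2)" using same x i by (auto simp: sg_def)
    moreover have "i \<notin> sg x2" using x by (auto simp: sg_def)
    ultimately show "\<exists>A. A \<in> sg ` G \<and> insert i A \<in> sg ` G \<and> i \<notin> A"
      using x by (intro exI[of _ "sg x2"]) (metis imageI)
  next
    show "sg ` G \<noteq> {}" using G_open[of UNIV] C by auto
  qed (auto simp: sg_def)
  have low_sg: "sg w = sg w'" if w: "w \<in> G" "w' \<in> G" and p: "lowest w p" "lowest w' p" for w w' p
  proof (rule ccontr)
    assume "sg w \<noteq> sg w'"
    then obtain i where i: "i \<in> I" "(l i \<bullet> w > 0) \<noteq> (l i \<bullet> w' > 0)" by (auto simp: sg_def)
    have nz: "l i \<bullet> w \<noteq> 0" "l i \<bullet> w' \<noteq> 0" using w i by (auto simp: G_def N_def)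
    \<comment> \<open>Weights for which the convex combination \<open>x\<close> of \<open>w\<close>
      and \<open>w'\<close> lies on hyperplane \<open>i\<close>; the values of \<open>l i\<close> at
      the two points have opposite signs.\<close>
    define a where "a = \<bar>l i \<bullet> w'\<bar>"
    define b where "b = \<bar>l i \<bullet> w\<bar>"
    have ab: "a > 0" "b > 0" using nz by (auto simp: a_def b_def)
    define x where "x = (a / (a + b)) *\<^sub>R w + (b / (a + b)) *\<^sub>R w'"
    have sum1: "a / (a + b) + b / (a + b) = 1" using ab by (simp flip: add_divide_distrib)
    have "x \<in> C" unfolding x_def using w ab sum1 C by (intro convexD) (auto simp: G_def)
    moreover have "a * (l i \<bullet> w) + b * (l i \<bullet> w') = 0"
      using i nz by (auto simp: a_def b_def abs_if)
    then have "l i \<bullet> x = 0"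
      by (simp add: x_def inner_add_right flip: add_divide_distrib)
    moreover have "lowest x p"
    proof -
      have "x \<bullet> p < x \<bullet> q" if q: "q \<in> S - {p}" for q
      proof -
        have "w \<bullet> p < w \<bullet> q" "w' \<bullet> p < w' \<bullet> q" using p q by (auto simp: lowest_def)
        then show ?thesis
          using ab by (auto simp: x_def inner_add_left intro!: add_strict_mono divide_strict_right_mono mult_strict_left_mono)
      qed
      then show ?thesis using p by (auto simp: lowest_def)
    qed
    ultimately show False using no_lowest i by blast
  qed
  define rep where "rep = (\<lambda>A. SOME w. w \<in> G \<and> sg w = A)"
  have rep: "rep A \<in> G" "sg (rep A) = A" if "A \<in> sg ` G" for A
    using that someI_ex[of "\<lambda>w. w \<in> G \<and> sg w = A"] by (auto simp: rep_def)
  define vtx where "vtx = (\<lambda>A. SOME p. lowest (rep A) p)"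
  have vtx: "lowest (rep A) (vtx A)" if "A \<in> sg ` G" for A
    using someI_ex[OF ex_low[OF rep(1)[OF that]]] by (simp add: vtx_def)
  define pre where "pre = (\<lambda>p. SOME x. x \<in> X \<and> e x = p)"
  have pre: "pre p \<in> X" "e (pre p) = p" if "p \<in> S" for p
    using that someI_ex[of "\<lambda>x. x \<in> X \<and> e x = p"] by (auto simp: pre_def S_def)
  have "inj_on (\<lambda>A. cls (pre (vtx A))) (sg ` G)"
  proof (rule inj_onI)
    fix A B assume AB: "A \<in> sg ` G" "B \<in> sg ` G" and eq: "cls (pre (vtx A)) = cls (pre (vtx B))"
    have S: "vtx A \<in> S" "vtx B \<in> S" using vtx AB by (auto simp: lowest_def)
    have "vtx A = vtx B"
    proof (rule ccontr)
      assume ne: "vtx A \<noteq> vtx B"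
      have "(\<forall>w\<in>C. w \<bullet> vtx A < w \<bullet> vtx B) \<or> (\<forall>w\<in>C. w \<bullet> vtx B < w \<bullet> vtx A)"
        using chain[of "pre (vtx A)" "pre (vtx B)"] pre S eq ne by auto
      moreover have "rep A \<in> C" "rep B \<in> C" using rep AB by (auto simp: G_def)
      moreover have "rep A \<bullet> vtx A < rep A \<bullet> vtx B" "rep B \<bullet> vtx B < rep B \<bullet> vtx A"
        using vtx[OF AB(1)] vtx[OF AB(2)] ne S by (auto simp: lowest_def)
      ultimately show False by force
    qed
    then have "sg (rep A) = sg (rep B)"
      using low_sg rep(1) vtx AB by metis
    then show "A = B" using rep AB by simp
  qed
  moreover have "(\<lambda>A. cls (pre (vtx A))) ` (sg ` G) \<subseteq> K"
    using pre vtx cls by (auto simp: lowest_def image_subset_iff)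
  ultimately have "card (sg ` G) \<le> card K"
    using fin(2) by (rule card_inj_on_le)
  then show ?thesis using pats by simp
qed

section \<open>Position sums of words\<close>

text \<open>The Fox derivative of the word by the letter \<open>k\<close>, evaluated at
  \<open>c \<mapsto> exp (\<theta> c)\<close>.\<close>

primrec pos_sum :: "'c list \<Rightarrow> 'c \<Rightarrow> ('c \<Rightarrow> real) \<Rightarrow> real" where
  "pos_sum [] k \<theta> = 0"
| "pos_sum (c # u) k \<theta> = (if c = k then 1 else 0) + exp (\<theta> c) * pos_sum u k \<theta>"

lemma pos_sum_append:
  "pos_sum (u @ v) k \<theta> = pos_sum u k \<theta> + exp (sum_list (map \<theta> u)) * pos_sum v k \<theta>"
  by (induction u) (auto simp: algebra_simps exp_add)

text \<open>The chain rule of Fox derivatives: an occurrence of \<open>a\<close> in the image lies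
  in the block of one unknown, and its prefix consists of the blocks before and a prefix of this
  block.\<close>

lemma pos_sum_apply_morph:
  fixes h :: "('x::finite, 'a) morph"
  shows "pos_sum (apply_morph h u) a \<tau> =
    (\<Sum>k\<in>UNIV. pos_sum u k (\<lambda>x. sum_list (map \<tau> (h x))) * pos_sum (h k) a \<tau>)"
proof (induction u)
  case Nil
  then show ?case by (simp add: apply_morph_def)
next
  case (Cons c u)
  let ?\<theta> = "\<lambda>x. sum_list (map \<tau> (h x))"
  have "pos_sum (apply_morph h (c # u)) a \<tau> = pos_sum (h c) a \<tau> + exp (?\<theta> c) * pos_sum (apply_morph h u) a \<tau>"
    by (simp add: apply_morph_def pos_sum_append)
  also have "\<dots> = (\<Sum>k\<in>UNIV. (if c = k then 1 else 0) * pos_sum (h k) a \<tau>)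
      + (\<Sum>k\<in>UNIV. exp (?\<theta> c) * (pos_sum u k ?\<theta> * pos_sum (h k) a \<tau>))"
    by (simp add: Cons sum_distrib_left if_distrib[of "\<lambda>x. x * _"] sum.delta' cong: if_cong)
  also have "\<dots> = (\<Sum>k\<in>UNIV. pos_sum (c # u) k ?\<theta> * pos_sum (h k) a \<tau>)"
    unfolding sum.distrib[symmetric] by (intro sum.cong) (auto simp: algebra_simps)
  finally show ?case .
qed

lemma isCont_pos_sum: "isCont (\<lambda>t. pos_sum u k (\<lambda>x. t * w x)) t"
  by (induction u) (auto intro!: continuous_intros)

lemma pos_sum_zero: "pos_sum u k (\<lambda>x. 0) = real (count_list u k)"
  by (induction u) auto

text \<open>The fundamental formula of Fox calculus: each letter contributes the difference of the
  exponentials of the prefixes after and before it.\<close>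

lemma pos_sum_telescope:
  fixes u :: "('x::finite) list"
  shows "(\<Sum>k\<in>UNIV. pos_sum u k \<theta> * (exp (\<theta> k) - 1)) = exp (sum_list (map \<theta> u)) - 1"
proof (induction u)
  case (Cons c u)
  have "(\<Sum>k\<in>UNIV. pos_sum (c # u) k \<theta> * (exp (\<theta> k) - 1))
    = (\<Sum>k\<in>UNIV. if c = k then exp (\<theta> k) - 1 else 0) + exp (\<theta> c) * (\<Sum>k\<in>UNIV. pos_sum u k \<theta> * (exp (\<theta> k) - 1))"
    unfolding sum_distrib_left sum.distrib[symmetric] by (intro sum.cong) (auto simp: algebra_simps)
  also have "\<dots> = exp (\<theta> c) - 1 + exp (\<theta> c) * (exp (sum_list (map \<theta> u)) - 1)"
    unfolding Cons by (simp add: sum.delta')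
  finally show ?case by (simp add: exp_add algebra_simps)
qed simp

lemma pos_sum_eq_sum:
  "pos_sum u k \<theta> = (\<Sum>j\<in>{j. j < length u \<and> u ! j = k}. exp (sum_list (map \<theta> (take j u))))"
proof (induction u)
  case (Cons c u)
  let ?J = "{j. j < length u \<and> u ! j = k}"
  have "{j. j < length (c # u) \<and> (c # u) ! j = k} = (if c = k then {0} else {}) \<union> Suc ` ?J"
    by (auto simp: less_Suc_eq_0_disj split: if_splits)
  then have "(\<Sum>j\<in>{j. j < length (c # u) \<and> (c # u) ! j = k}. exp (sum_list (map \<theta> (take j (c # u)))))
     = (if c = k then 1 else 0) + (\<Sum>j\<in>Suc ` ?J. exp (sum_list (map \<theta> (take j (c # u)))))"
    by (simp add: sum.union_disjoint)
  also have "(\<Sum>j\<in>Suc ` ?J. exp (sum_list (map \<theta> (take j (c # u))))) = exp (\<theta> c) * pos_sum u k \<theta>"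
    by (simp add: sum.reindex Cons sum_distrib_left exp_add)
  finally show ?case by simp
qed simp

lemma pos_sum_nonneg: "pos_sum u k \<theta> \<ge> 0"
  by (induction u) auto

lemma pos_sum_le_length:
  assumes "\<And>x. \<theta> x \<le> 0"
  shows "pos_sum u k \<theta> \<le> length u"
proof (induction u)
  case (Cons c u)
  have "exp (\<theta> c) * pos_sum u k \<theta> \<le> 1 * pos_sum u k \<theta>"
    using assms by (intro mult_right_mono pos_sum_nonneg) simp
  then show ?case using Cons by auto
qed simp

text \<open>For very negative \<open>t\<close> the head \<open>c\<close> damps all occurrences of
  \<open>d\<close> behind it, whereas a head \<open>d\<close> contributes 1.\<close>

lemma pos_sum_heads_differ:
  assumes "\<And>x. \<omega> x \<ge> 0" "c \<noteq> d" "\<omega> c > 0"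
  shows "\<exists>t. pos_sum (c # u) d (\<lambda>x. t * \<omega> x) \<noteq> pos_sum (d # v) d (\<lambda>x. t * \<omega> x)"
proof -
  \<comment> \<open>The damping factor becomes 1 over \<open>length u + 1\<close>, while the sum for
    \<open>u\<close> is at most \<open>length u\<close>.\<close>
  define t where "t = - ln (real (length u) + 1) / \<omega> c"
  have t: "t \<le> 0" using assms by (simp add: t_def)
  have "exp (t * \<omega> c) = 1 / (real (length u) + 1)"
    using assms by (simp add: t_def exp_minus inverse_eq_divide)
  moreover have "pos_sum u d (\<lambda>x. t * \<omega> x) < real (length u) + 1"
    using t assms pos_sum_le_length[of "\<lambda>x. t * \<omega> x" u d] by (simp add: mult_nonpos_nonneg)
  ultimately have "pos_sum (c # u) d (\<lambda>x. t * \<omega> x) < 1"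
    using assms by simp
  moreover have "pos_sum (d # v) d (\<lambda>x. t * \<omega> x) \<ge> 1" by (simp add: pos_sum_nonneg)
  ultimately show ?thesis by (intro exI[of _ t]) linarith
qed

lemma pos_sum_inject:
  assumes \<omega>: "\<And>x. \<omega> x \<ge> 0" "\<And>x y. x \<noteq> y \<Longrightarrow> \<omega> x > 0 \<or> \<omega> y > 0"
    and eq: "\<And>k t. pos_sum u k (\<lambda>x. t * \<omega> x) = pos_sum v k (\<lambda>x. t * \<omega> x)"
  shows "u = v"
  using eq
proof (induction u arbitrary: v)
  case Nil
  show ?case
  proof (cases v)
    case (Cons d v')
    have "pos_sum v d (\<lambda>x. 0 * \<omega> x) \<ge> 1" by (simp add: Cons pos_sum_nonneg)
    then show ?thesis using Nil[of d 0] by simp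
  qed simp
next
  case (Cons c u)
  show ?case
  proof (cases v)
    case Nil
    have "pos_sum (c # u) c (\<lambda>x. 0 * \<omega> x) \<ge> 1" by (simp add: pos_sum_nonneg)
    then show ?thesis using Cons.prems[of c 0] Nil by simp
  next
    case v: (Cons d v')
    have "c = d"
    proof (rule ccontr)
      assume "c \<noteq> d"
      then consider "\<omega> c > 0" | "\<omega> d > 0" using \<omega>(2) by blast
      then show False
      proof cases
        case 1
        then show False using pos_sum_heads_differ[of \<omega> c d u v'] \<omega>(1) \<open>c \<noteq> d\<close> Cons.prems v by metis
      next
        case 2
        then show False using pos_sum_heads_differ[of \<omega> d c v' u] \<omega>(1) \<open>c \<noteq> d\<close> Cons.prems v by metis
      qed
    qed
    moreover have "u = v'"
    proof (rule Cons.IH)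
      fix k t
      show "pos_sum u k (\<lambda>x. t * \<omega> x) = pos_sum v' k (\<lambda>x. t * \<omega> x)"
        using Cons.prems[of k t] v \<open>c = d\<close> by simp
    qed
    ultimately show ?thesis using v by simp
  qed
qed

text \<open>The difference of the two sides is a single exponential sum in \<open>t\<close>, indexed
  by the disjoint union of the occurrences, so \<open>exp_sum_extend\<close> applies.\<close>

lemma pos_sum_extend:
  assumes "a < b" "\<And>t. a < t \<Longrightarrow> t < b \<Longrightarrow> pos_sum u k (\<lambda>x. t * \<omega> x) = pos_sum v k (\<lambda>x. t * \<omega> x)"
  shows "pos_sum u k (\<lambda>x. t * \<omega> x) = pos_sum v k (\<lambda>x. t * \<omega> x)"
proof -
  define I where "I = {j. j < length u \<and> u ! j = k} <+> {j. j < length v \<and> v ! j = k}"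
  define s :: "nat + nat \<Rightarrow> real" where "s = case_sum (\<lambda>_. 1) (\<lambda>_. - 1)"
  define r where "r = case_sum (\<lambda>j. sum_list (map \<omega> (take j u))) (\<lambda>j. sum_list (map \<omega> (take j v)))"
  have eq: "pos_sum u k (\<lambda>x. t * \<omega> x) - pos_sum v k (\<lambda>x. t * \<omega> x) = (\<Sum>i\<in>I. s i * exp (t * r i))" for t
    unfolding I_def pos_sum_eq_sum
    by (subst sum.Plus) (simp_all add: s_def r_def sum_list_const_mult sum_negf)
  have "(\<Sum>i\<in>I. s i * exp (t * r i)) = 0"
  proof (rule exp_sum_extend[OF _ assms(1)])
    show "finite I" by (simp add: I_def)
    show "(\<Sum>i\<in>I. s i * exp (t * r i)) = 0" if "a < t" "t < b" for t
      using assms(2)[OF that] eq[of t] by simp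
  qed
  then show ?thesis using eq[of t] by simp
qed

lemma pos_sum_filter:
  assumes "\<theta> z = 0"
  shows "pos_sum (filter (\<lambda>x. x \<noteq> z) u) k \<theta> = (if k = z then 0 else pos_sum u k \<theta>)"
  using assms by (induction u) auto

lemma sum_list_map_eq_sum_superset:
  assumes "finite A" "\<And>a. a \<notin> A \<Longrightarrow> f a = (0::real)"
  shows "sum_list (map f u) = (\<Sum>a\<in>A. f a * real (count_list u a))"
proof (induction u)
  case (Cons c u)
  have "(\<Sum>a\<in>A. f a * real (count_list (c # u) a))
      = (\<Sum>a\<in>A. if c = a then f a else 0) + (\<Sum>a\<in>A. f a * real (count_list u a))"
    unfolding sum.distrib[symmetric] by (intro sum.cong) (auto simp: algebra_simps)
  then show ?case using assms Cons by (simp add: sum.delta')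
qed simp

lemma sum_list_map_eq_sum_UNIV:
  "sum_list (map f u) = (\<Sum>a\<in>UNIV. f a * real (count_list u a))" for u :: "('x::finite) list"
  by (rule sum_list_map_eq_sum_superset) auto

section \<open>Solutions of rank n - 1\<close>

interpretation rat_fun: vector_space qsmul
  by (rule vector_space_qsmul)

lemma sum_fun_apply: "(\<Sum>i\<in>I. f i) x = (\<Sum>i\<in>I. f i x)"
  for f :: "'i \<Rightarrow> 'x \<Rightarrow> rat"
  by (induction I rule: infinite_finite_induct) auto

lemma fun_eq_unit_sum: "(v :: 'x::finite \<Rightarrow> rat) = (\<Sum>x\<in>UNIV. qsmul (v x) (\<lambda>y. if y = x then 1 else 0))"
  by (rule ext) (simp add: sum_fun_apply qsmul_def if_distrib sum.delta cong: if_cong)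

lemma dim_fun_UNIV: "rat_fun.dim (UNIV :: ('x::finite \<Rightarrow> rat) set) = CARD('x)"
proof -
  define \<delta> :: "'x \<Rightarrow> 'x \<Rightarrow> rat" where "\<delta> = (\<lambda>x y. if y = x then 1 else 0)"
  have inj: "inj \<delta>"
  proof (rule injI)
    fix x y assume "\<delta> x = \<delta> y"
    then have "\<delta> x x = \<delta> y x" by simp
    then show "x = y" by (simp add: \<delta>_def split: if_splits)
  qed
  have "rat_fun.independent (range \<delta>)"
  proof (rule rat_fun.independent_if_scalars_zero)
    fix f v assume z: "(\<Sum>v\<in>range \<delta>. qsmul (f v) v) = 0" and "v \<in> range \<delta>"
    then obtain x where x: "v = \<delta> x" by auto
    have "(\<Sum>v\<in>range \<delta>. qsmul (f v) v) = (\<Sum>y\<in>UNIV. qsmul (f (\<delta> y)) (\<delta> y))"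
      using inj by (simp add: sum.reindex)
    then have "(\<Sum>y\<in>UNIV. qsmul (f (\<delta> y)) (\<delta> y)) x = 0" using z by simp
    then show "f v = 0"
      by (simp add: sum_fun_apply qsmul_def \<delta>_def x if_distrib sum.delta' cong: if_cong)
  qed simp
  moreover have "v \<in> rat_fun.span (range \<delta>)" for v
    by (subst fun_eq_unit_sum) (intro rat_fun.span_sum rat_fun.span_scale rat_fun.span_base, simp add: \<delta>_def)
  ultimately have "rat_fun.dim (UNIV :: ('x \<Rightarrow> rat) set) = card (range \<delta>)"
    by (intro rat_fun.dim_eq_card) auto
  then show ?thesis using inj by (simp add: card_image)
qed

text \<open>Equality instead of inclusion makes \<open>l\<close> unique up to a factor, so that it
  stands for the linear equivalence class of \<open>h\<close>.\<close>

definition normal_to :: "('x::finite, 'a) morph \<Rightarrow> ('x \<Rightarrow> rat) \<Rightarrow> bool" where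
  "normal_to h l \<longleftrightarrow> (\<exists>x. l x \<noteq> 0) \<and> Defs.Gamma h = {v. (\<Sum>x\<in>UNIV. v x * l x) = 0}"

text \<open>A basis of \<open>Gamma h\<close> needs just one more vector \<open>b\<close> to span
  everything. The coordinate of \<open>b\<close> is a linear functional with kernel
  \<open>Gamma h\<close>, and \<open>l\<close> lists its values at the unit vectors.\<close>

lemma morph_rank_normal:
  fixes h :: "('x::finite, 'a) morph"
  assumes rk: "morph_rank h = CARD('x) - 1" and n: "CARD('x) \<ge> 2"
  shows "\<exists>l. normal_to h l"
proof -
  obtain B where B: "B \<subseteq> Defs.Gamma h" "rat_fun.independent B" "Defs.Gamma h \<subseteq> rat_fun.span B" "card B = rat_fun.dim (Defs.Gamma h)"
    by (rule rat_fun.basis_exists)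
  have cB: "card B = CARD('x) - 1" using B rk by (simp add: morph_rank_def)
  have "rat_fun.span B \<subseteq> Defs.Gamma h"
    using B(1) by (intro rat_fun.span_minimal) (auto simp: Defs.Gamma_def)
  then have spB: "rat_fun.span B = Defs.Gamma h" using B by auto
  define B' where "B' = rat_fun.extend_basis B"
  have B': "B \<subseteq> B'" "rat_fun.independent B'" "rat_fun.span B' = UNIV"
    using rat_fun.extend_basis_superset[OF B(2)] rat_fun.independent_extend_basis[OF B(2)] rat_fun.span_extend_basis[OF B(2)]
    by (simp_all add: B'_def)
  have cB': "card B' = CARD('x)" using rat_fun.dim_eq_card[of B' UNIV] B' dim_fun_UNIV[where 'x = 'x] by simp
  then have fB': "finite B'" using n card.infinite by fastforce
  have fB: "finite B" using fB' B' finite_subset by blast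
  have "card (B' - B) = 1" using cB cB' n B' fB by (simp add: card_Diff_subset)
  then obtain b where b: "B' - B = {b}" by (rule card_1_singletonE)
  define f where "f = (\<lambda>v. rat_fun.representation B' v b)"
  define l where "l = (\<lambda>x. f (\<lambda>y. if y = x then 1 else 0))"
  have fl: "f v = (\<Sum>x\<in>UNIV. v x * l x)" for v
    unfolding f_def l_def
    by (subst fun_eq_unit_sum[of v], subst rat_fun.representation_sum) (simp_all add: B' rat_fun.representation_scale)
  have "v \<in> rat_fun.span B \<longleftrightarrow> f v = 0" for v
  proof
    assume v: "v \<in> rat_fun.span B"
    then have "f v = rat_fun.representation B v b"
      using rat_fun.representation_extend[OF B'(2) v B'(1)] by (simp add: f_def)
    then show "f v = 0" using rat_fun.representation_ne_zero[of B v b] b by auto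
  next
    assume "f v = 0"
    have "v = (\<Sum>c\<in>B'. qsmul (rat_fun.representation B' v c) c)"
      using rat_fun.sum_representation_eq[of B' v B'] B' fB' by simp
    also have "\<dots> = (\<Sum>c\<in>B. qsmul (rat_fun.representation B' v c) c)"
      using b B' fB' \<open>f v = 0\<close> by (intro sum.mono_neutral_right) (auto simp: f_def)
    also have "\<dots> \<in> rat_fun.span B" by (intro rat_fun.span_sum rat_fun.span_scale rat_fun.span_base)
    finally show "v \<in> rat_fun.span B" .
  qed
  then have "Defs.Gamma h = {v. (\<Sum>x\<in>UNIV. v x * l x) = 0}" using spB fl by auto
  moreover have "b \<in> B'" using b by auto
  then have "f b = 1" using B'(2) rat_fun.representation_basis[of B' b] by (simp add: f_def)
  have "\<exists>x. l x \<noteq> 0"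
  proof (rule ccontr)
    assume "\<not> (\<exists>x. l x \<noteq> 0)"
    then have "f b = 0" by (subst fl) simp
    then show False using \<open>f b = 1\<close> by simp
  qed
  ultimately show ?thesis by (auto simp: normal_to_def)
qed

text \<open>The vectors \<open>kink l i j\<close> with \<open>l i \<noteq> 0\<close> and \<open>j \<noteq> i\<close> form a basis of the hyperplane normal to \<open>l\<close>.\<close>

definition kink :: "('x \<Rightarrow> 'r::ring) \<Rightarrow> 'x \<Rightarrow> 'x \<Rightarrow> 'x \<Rightarrow> 'r" where
  "kink l i j x = (if x = j then l i else 0) - (if x = i then l j else 0)"

lemma sum_kink:
  fixes l :: "'x::finite \<Rightarrow> 'r::comm_ring"
  shows "(\<Sum>x\<in>UNIV. f x * kink l i j x) = f j * l i - f i * l j"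
  unfolding kink_def right_diff_distrib sum_subtractf
  by (simp add: if_distrib sum.delta cong: if_cong)

text \<open>\<open>kink l i j\<close> is orthogonal to \<open>l\<close> and hence in the rational
  span of the Parikh vectors. Finitely many letters suffice, and the coefficients are passed to the
  reals.\<close>

lemma normal_to_comb:
  fixes h :: "('x::finite, 'a) morph"
  assumes l: "normal_to h l"
  shows "\<exists>F c. finite F \<and> (\<forall>x. kink (\<lambda>x. real_of_rat (l x)) i j x = (\<Sum>a\<in>F. c a * real (count_list (h x) a)))"
proof -
  have "kink l i j \<in> Defs.Gamma h"
    using l sum_kink[of l l i j] by (simp add: normal_to_def mult.commute)
  then obtain t r where t: "finite t" "t \<subseteq> range (gamma h)" "kink l i j = (\<Sum>v\<in>t. qsmul (r v) v)"
    unfolding Defs.Gamma_def rat_fun.span_explicit by auto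
  define pre where "pre = (\<lambda>v. SOME a. gamma h a = v)"
  have pre: "gamma h (pre v) = v" if "v \<in> t" for v
    using t that someI_ex[of "\<lambda>a. gamma h a = v"] by (auto simp: pre_def)
  then have inj: "inj_on pre t" by (metis inj_onI)
  have "kink l i j x = (\<Sum>a\<in>pre ` t. r (gamma h a) * of_nat (count_list (h x) a))" for x
  proof -
    have "kink l i j x = (\<Sum>v\<in>t. r v * v x)" by (simp add: t(3) sum_fun_apply qsmul_def)
    also have "\<dots> = (\<Sum>v\<in>t. r (gamma h (pre v)) * of_nat (count_list (h x) (pre v)))"
    proof (intro sum.cong refl)
      fix v assume "v \<in> t"
      then have "v x = of_nat (count_list (h x) (pre v))" using fun_cong[OF pre[of v], of x] by (simp add: gamma_def)
      then show "r v * v x = r (gamma h (pre v)) * of_nat (count_list (h x) (pre v))"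
        using pre \<open>v \<in> t\<close> by simp
    qed
    finally show ?thesis using inj by (simp add: sum.reindex)
  qed
  then have "real_of_rat (kink l i j x) = (\<Sum>a\<in>pre ` t. real_of_rat (r (gamma h a)) * real (count_list (h x) a))" for x
    by (simp add: of_rat_sum of_rat_mult)
  moreover have "real_of_rat (kink l i j x) = kink (\<lambda>x. real_of_rat (l x)) i j x" for x
    by (simp add: kink_def of_rat_diff)
  ultimately show ?thesis using t by (intro exI[of _ "pre ` t"] exI[of _ "\<lambda>a. real_of_rat (r (gamma h a))"]) simp
qed

lemma normal_to_orth:
  assumes "normal_to h l"
  shows "(\<Sum>x\<in>UNIV. real (count_list (h x) a) * real_of_rat (l x)) = 0"
proof -
  have "gamma h a \<in> Defs.Gamma h" unfolding Defs.Gamma_def by (intro rat_fun.span_base) simp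
  then have "(\<Sum>x\<in>UNIV. gamma h a x * l x) = 0" using assms by (simp add: normal_to_def)
  then have "real_of_rat (\<Sum>x\<in>UNIV. gamma h a x * l x) = 0" by simp
  then show ?thesis by (simp add: of_rat_sum of_rat_mult gamma_def)
qed

section \<open>Vanishing of the minors on the hyperplane of a common solution\<close>

definition eq_sum :: "'x equation \<Rightarrow> 'x \<Rightarrow> ('x \<Rightarrow> real) \<Rightarrow> real" where
  "eq_sum E k \<theta> = pos_sum (fst E) k \<theta> - pos_sum (snd E) k \<theta>"

definition eq_minor :: "'x equation \<Rightarrow> 'x equation \<Rightarrow> 'x \<Rightarrow> 'x \<Rightarrow> ('x \<Rightarrow> real) \<Rightarrow> real" where
  "eq_minor E E' k l \<theta> = eq_sum E k \<theta> * eq_sum E' l \<theta> - eq_sum E l \<theta> * eq_sum E' k \<theta>"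

lemma isCont_eq_sum: "isCont (\<lambda>t. eq_sum E k (\<lambda>x. t * w x)) t"
  unfolding eq_sum_def by (intro continuous_intros isCont_pos_sum)

text \<open>As \<open>t\<close> tends to 0, the position sums of \<open>h\<close> tend to its letter counts, so the orthogonality
  conditions form a system close to the diagonal system given by the vectors \<open>kink l i j\<close>.\<close>

lemma orth_near_zero:
  fixes h :: "('x::finite, 'a) morph" and w :: "'x \<Rightarrow> real"
  assumes l: "normal_to h l" and i: "l i \<noteq> 0"
    and w: "(\<Sum>x\<in>UNIV. w x * real_of_rat (l x)) = 0"
  shows "\<exists>\<tau> \<delta>. \<delta> > 0 \<and> (\<forall>x. w x = sum_list (map \<tau> (h x))) \<and>
     (\<forall>t S. 0 < t \<and> t < \<delta> \<and> S i = 0 \<and> (\<forall>a. (\<Sum>x\<in>UNIV. S x * pos_sum (h x) a (\<lambda>b. t * \<tau> b)) = 0)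
        \<longrightarrow> (\<forall>x. S x = 0))"
proof -
  let ?L = "\<lambda>x. real_of_rat (l x)"
  have Li: "?L i \<noteq> 0" using i by simp
  have "\<forall>j. \<exists>F c. finite F \<and> (\<forall>x. kink ?L i j x = (\<Sum>a\<in>F. c a * real (count_list (h x) a)))"
    using normal_to_comb[OF l] by blast
  then obtain F c where F: "\<And>j. finite (F j)"
    "\<And>j x. kink ?L i j x = (\<Sum>a\<in>F j. c j a * real (count_list (h x) a))" by metis
  define A where "A = (\<Union>j. F j)"
  define d where "d = (\<lambda>j a. if a \<in> F j then c j a else 0)"
  have fA: "finite A" using F by (simp add: A_def)
  have d: "kink ?L i j x = (\<Sum>a\<in>A. d j a * real (count_list (h x) a))" for j x
    unfolding F(2) d_def using fA by (intro sum.mono_neutral_cong_left) (auto simp: A_def)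
  \<comment> \<open>Letter weights that induce \<open>w\<close>: on the hyperplane, \<open>w\<close>
    is the combination of the vectors \<open>kink ?L i j\<close> with coefficients
    \<open>w j / ?L i\<close>, and these vectors are combinations of Parikh vectors.\<close>
  define \<tau> where "\<tau> = (\<lambda>a. \<Sum>j\<in>UNIV. w j / ?L i * d j a)"
  have \<tau>0: "\<tau> a = 0" if "a \<notin> A" for a
    using that by (auto simp: \<tau>_def d_def A_def)
  have \<tau>: "w x = sum_list (map \<tau> (h x))" for x
  proof -
    have "sum_list (map \<tau> (h x)) = (\<Sum>a\<in>A. \<Sum>j\<in>UNIV. w j / ?L i * (d j a * real (count_list (h x) a)))"
      by (simp add: sum_list_map_eq_sum_superset[OF fA \<tau>0]) (simp add: \<tau>_def sum_distrib_right mult.assoc)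
    also have "\<dots> = (\<Sum>j\<in>UNIV. w j / ?L i * kink ?L i j x)"
      by (subst sum.swap) (simp add: d sum_distrib_left)
    also have "\<dots> = (\<Sum>j\<in>UNIV. if x = j then w j else 0) - (\<Sum>j\<in>UNIV. (if x = i then w j * ?L j / ?L i else 0))"
      unfolding sum_subtractf[symmetric] using Li by (intro sum.cong) (auto simp: kink_def)
    also have "\<dots> = w x"
      using w by (cases "x = i") (simp_all add: sum_divide_distrib[symmetric])
    finally show ?thesis by simp
  qed
  define V where "V = (\<lambda>j t x. \<Sum>a\<in>A. d j a * pos_sum (h x) a (\<lambda>b. t * \<tau> b))"
  \<comment> \<open>Errors below this bound, summed over all unknowns, amount to at most half of the
    diagonal entry.\<close>
  define \<eta> where "\<eta> = \<bar>?L i\<bar> / (2 * CARD('x))"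
  have \<eta>: "\<eta> > 0" using Li by (simp add: \<eta>_def)
  have "\<forall>\<^sub>F t in at_right 0. \<forall>j x. \<bar>V j t x - kink ?L i j x\<bar> < \<eta>"
  proof (intro eventually_all_finite)
    fix j x
    have "isCont (\<lambda>t. V j t x) 0"
      unfolding V_def by (intro continuous_intros isCont_pos_sum)
    then have "((\<lambda>t. V j t x) \<longlongrightarrow> V j 0 x) (at_right 0)"
      unfolding isCont_def by (rule tendsto_within_subset) simp
    moreover have "V j 0 x = kink ?L i j x" by (simp add: V_def d pos_sum_zero)
    ultimately show "\<forall>\<^sub>F t in at_right 0. \<bar>V j t x - kink ?L i j x\<bar> < \<eta>"
      using \<eta> by (simp add: tendsto_iff dist_real_def)
  qed
  then obtain \<delta> where \<delta>: "\<delta> > 0" "\<And>t j x. 0 < t \<Longrightarrow> t < \<delta> \<Longrightarrow> \<bar>V j t x - kink ?L i j x\<bar> < \<eta>"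
    unfolding eventually_at_right_field by blast
  have "S x = 0" if t: "0 < t" "t < \<delta>" and Si: "S i = 0"
    and orth: "\<And>a. (\<Sum>x\<in>UNIV. S x * pos_sum (h x) a (\<lambda>b. t * \<tau> b)) = 0" for t S x
  proof -
    \<comment> \<open>Diagonal dominance: at an index \<open>y\<close> where \<open>S\<close> is
      largest in modulus, the errors cannot balance the diagonal term unless
      \<open>S y = 0\<close>.\<close>
    have "finite (range (\<lambda>x. \<bar>S x\<bar>))" "range (\<lambda>x. \<bar>S x\<bar>) \<noteq> {}" by auto
    from Max_in[OF this] obtain y where y': "Max (range (\<lambda>x. \<bar>S x\<bar>)) = \<bar>S y\<bar>" by (rule imageE)
    have y: "\<bar>S x\<bar> \<le> \<bar>S y\<bar>" for x unfolding y'[symmetric] by (rule Max_ge) auto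
    have "(\<Sum>x\<in>UNIV. S x * V y t x) = (\<Sum>a\<in>A. d y a * (\<Sum>x\<in>UNIV. S x * pos_sum (h x) a (\<lambda>b. t * \<tau> b)))"
      unfolding V_def sum_distrib_left by (subst sum.swap) (simp add: mult.left_commute)
    also have "\<dots> = 0" using orth by simp
    finally have 0: "(\<Sum>x\<in>UNIV. S x * V y t x) = 0" .
    have "S y * ?L i = (\<Sum>x\<in>UNIV. S x * kink ?L i y x)" using Si by (simp add: sum_kink)
    also have "\<dots> = (\<Sum>x\<in>UNIV. S x * (kink ?L i y x - V y t x))"
      using 0 by (simp add: right_diff_distrib sum_subtractf)
    finally have "\<bar>S y * ?L i\<bar> \<le> (\<Sum>x\<in>UNIV. \<bar>S x * (kink ?L i y x - V y t x)\<bar>)"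
      by (metis sum_abs)
    also have "\<dots> \<le> (\<Sum>x\<in>(UNIV::'x set). \<bar>S y\<bar> * \<eta>)"
    proof (intro sum_mono)
      fix x
      have "\<bar>kink ?L i y x - V y t x\<bar> \<le> \<eta>" using \<delta>(2)[OF t, of y x] by linarith
      then show "\<bar>S x * (kink ?L i y x - V y t x)\<bar> \<le> \<bar>S y\<bar> * \<eta>"
        unfolding abs_mult using y by (intro mult_mono) auto
    qed
    also have "\<dots> = \<bar>S y\<bar> * \<bar>?L i\<bar> / 2" by (simp add: \<eta>_def)
    finally have "\<bar>S y\<bar> * \<bar>?L i\<bar> \<le> 0" by (simp add: abs_mult)
    then have "S y = 0" using Li by (simp add: mult_le_0_iff)
    then show ?thesis using y[of x] by simp
  qed
  then show ?thesis using \<delta>(1) \<tau> by blast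
qed

text \<open>By the chain rule \<open>pos_sum_apply_morph\<close> this sum is the difference of the
  position sums of two equal images.\<close>

lemma solution_orth:
  fixes h :: "('x::finite, 'a) morph"
  assumes "is_solution E h" "\<And>x. \<theta> x = sum_list (map \<tau> (h x))"
  shows "(\<Sum>x\<in>UNIV. eq_sum E x \<theta> * pos_sum (h x) a \<tau>) = 0"
proof -
  have \<theta>: "\<theta> = (\<lambda>x. sum_list (map \<tau> (h x)))" using assms(2) by auto
  have "pos_sum (apply_morph h (fst E)) a \<tau> - pos_sum (apply_morph h (snd E)) a \<tau> = 0"
    using assms(1) by (simp add: is_solution_def)
  then show ?thesis
    by (simp add: pos_sum_apply_morph eq_sum_def \<theta> left_diff_distrib sum_subtractf)
qed

text \<open>The sums of both equations are orthogonal to the position sums of \<open>h\<close>, and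
  by \<open>orth_near_zero\<close> coordinate \<open>i\<close> determines such a vector. Hence the
  combination that vanishes at \<open>i\<close> is zero and the two vectors are
  proportional.\<close>

lemma eq_minor_vanish:
  fixes h :: "('x::finite, 'a) morph"
  assumes l: "normal_to h l" and sol: "is_solution E h" "is_solution E' h"
    and w: "(\<Sum>x\<in>UNIV. w x * real_of_rat (l x)) = 0"
  shows "\<exists>\<delta>>0. \<forall>t. 0 < t \<and> t < \<delta> \<longrightarrow> eq_minor E E' k k' (\<lambda>x. t * w x) = 0"
proof -
  obtain i where i: "l i \<noteq> 0" using l by (auto simp: normal_to_def)
  obtain \<tau> \<delta> where \<tau>: "\<delta> > 0" "\<And>x. w x = sum_list (map \<tau> (h x))"
    "\<And>t S x. 0 < t \<Longrightarrow> t < \<delta> \<Longrightarrow> S i = 0 \<Longrightarrow>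
      (\<And>a. (\<Sum>x\<in>UNIV. S x * pos_sum (h x) a (\<lambda>b. t * \<tau> b)) = 0) \<Longrightarrow> S x = 0"
    using orth_near_zero[OF l i w] by blast
  have "eq_minor E E' k k' (\<lambda>x. t * w x) = 0" if t: "0 < t" "t < \<delta>" for t
  proof -
    define T where "T = (\<lambda>x. eq_sum E x (\<lambda>x. t * w x))"
    define T' where "T' = (\<lambda>x. eq_sum E' x (\<lambda>x. t * w x))"
    have tw: "t * w x = sum_list (map (\<lambda>b. t * \<tau> b) (h x))" for x
      by (simp add: \<tau>(2) sum_list_const_mult)
    have orth: "(\<Sum>x\<in>UNIV. T x * pos_sum (h x) a (\<lambda>b. t * \<tau> b)) = 0"
      "(\<Sum>x\<in>UNIV. T' x * pos_sum (h x) a (\<lambda>b. t * \<tau> b)) = 0" for a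
      unfolding T_def T'_def using solution_orth[OF sol(1) tw] solution_orth[OF sol(2) tw] by blast+
    have par: "T' i * T x - T i * T' x = 0" for x
    proof (rule \<tau>(3)[OF t, where S = "\<lambda>x. T' i * T x - T i * T' x"])
      fix a
      have "(\<Sum>x\<in>UNIV. (T' i * T x - T i * T' x) * pos_sum (h x) a (\<lambda>b. t * \<tau> b))
        = T' i * (\<Sum>x\<in>UNIV. T x * pos_sum (h x) a (\<lambda>b. t * \<tau> b)) - T i * (\<Sum>x\<in>UNIV. T' x * pos_sum (h x) a (\<lambda>b. t * \<tau> b))"
        by (simp add: left_diff_distrib sum_subtractf sum_distrib_left mult.assoc)
      also have "\<dots> = 0" by (simp only: orth mult_zero_right diff_zero)
      finally show "(\<Sum>x\<in>UNIV. (T' i * T x - T i * T' x) * pos_sum (h x) a (\<lambda>b. t * \<tau> b)) = 0" .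
    qed simp
    have "T k * T' k' - T k' * T' k = 0"
    proof (cases "T i = 0 \<and> T' i = 0")
      case True
      have "T x = 0" for x using \<tau>(3)[OF t, of T] True orth by blast
      then show ?thesis by simp
    next
      case False
      have "T i * (T k * T' k' - T k' * T' k) = 0" "T' i * (T k * T' k' - T k' * T' k) = 0"
        using par[of k] par[of k'] by algebra+
      then show ?thesis using False by auto
    qed
    then show ?thesis by (simp add: eq_minor_def T_def T'_def)
  qed
  then show ?thesis using \<tau>(1) by blast
qed

section \<open>Solutions that erase an unknown\<close>

text \<open>All of \<open>Gamma h\<close> has coordinate 0 at \<open>z\<close>, but for
  \<open>i \<noteq> z\<close> the vector \<open>kink l i z\<close> belongs to it and has coordinate
  \<open>l i\<close> there.\<close>

lemma normal_to_erased:
  fixes h :: "('x::finite, 'a) morph"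
  assumes l: "normal_to h l" and z: "h z = []"
  shows "l z \<noteq> 0" "x \<noteq> z \<Longrightarrow> l x = 0"
proof -
  have *: "i = z" if "l i \<noteq> 0" for i
  proof (rule ccontr)
    assume "i \<noteq> z"
    obtain F c where "\<forall>x. kink (\<lambda>x. real_of_rat (l x)) i z x = (\<Sum>a\<in>F. c a * real (count_list (h x) a))"
      using normal_to_comb[OF l] by blast
    then have "kink (\<lambda>x. real_of_rat (l x)) i z z = 0" using z by simp
    then show False using that \<open>i \<noteq> z\<close> by (simp add: kink_def)
  qed
  then show "l z \<noteq> 0" using l by (auto simp: normal_to_def)
  show "x \<noteq> z \<Longrightarrow> l x = 0" using * by blast
qed

text \<open>The length vector is the sum of the Parikh vectors. It is a nonnegative point of the
  hyperplane, positive at every unknown that is not erased.\<close>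

lemma normal_to_lengths:
  fixes h :: "('x::finite, 'a) morph"
  assumes "normal_to h l"
  shows "(\<Sum>x\<in>UNIV. real (length (h x)) * real_of_rat (l x)) = 0"
proof -
  define A where "A = (\<Union>x. set (h x))"
  have "finite A" by (simp add: A_def)
  have len: "real (length (h x)) = (\<Sum>a\<in>A. real (count_list (h x) a))" for x
  proof -
    have "set (h x) \<subseteq> A" by (auto simp: A_def)
    from sum_count_set[OF this \<open>finite A\<close>] show ?thesis by (simp flip: of_nat_sum)
  qed
  show ?thesis
    unfolding len sum_distrib_right by (subst sum.swap) (simp add: normal_to_orth[OF assms])
qed

text \<open>The orthogonality conditions, now without coordinate \<open>z\<close>, force all other
  sums along the length vector to vanish, and these determine the words left after deleting
  \<open>z\<close>.\<close>

lemma erased_filter_eq: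
  fixes h :: "('x::finite, 'a) morph"
  assumes l: "normal_to h l" and sol: "is_solution E h" and z: "h z = []"
  shows "filter (\<lambda>x. x \<noteq> z) (fst E) = filter (\<lambda>x. x \<noteq> z) (snd E)"
proof -
  define \<omega> where "\<omega> = (\<lambda>x. real (length (h x)))"
  have "(\<Sum>x\<in>UNIV. \<omega> x * real_of_rat (l x)) = 0"
    using normal_to_lengths[OF l] by (simp add: \<omega>_def)
  from orth_near_zero[OF l normal_to_erased(1)[OF l z] this]
  obtain \<tau> \<delta> where \<tau>: "\<delta> > 0" "\<And>x. \<omega> x = sum_list (map \<tau> (h x))"
    "\<And>t S x. 0 < t \<Longrightarrow> t < \<delta> \<Longrightarrow> S z = 0 \<Longrightarrow>
      (\<And>a. (\<Sum>x\<in>UNIV. S x * pos_sum (h x) a (\<lambda>b. t * \<tau> b)) = 0) \<Longrightarrow> S x = 0"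
    by blast
  have vanish: "eq_sum E k (\<lambda>x. t * \<omega> x) = 0" if t: "0 < t" "t < \<delta>" and "k \<noteq> z" for t k
  proof -
    \<comment> \<open>As \<open>h z\<close> is empty, its position sums are 0 and the coordinate at
      \<open>z\<close> may be reset to 0.\<close>
    define S where "S = (\<lambda>x. if x = z then 0 else eq_sum E x (\<lambda>x. t * \<omega> x))"
    have "S k = 0"
    proof (rule \<tau>(3)[OF t])
      fix a
      have "(\<Sum>x\<in>UNIV. S x * pos_sum (h x) a (\<lambda>b. t * \<tau> b))
          = (\<Sum>x\<in>UNIV. eq_sum E x (\<lambda>x. t * \<omega> x) * pos_sum (h x) a (\<lambda>b. t * \<tau> b))"
        using z by (intro sum.cong) (auto simp: S_def)
      also have "\<dots> = 0"
        by (rule solution_orth[OF sol]) (simp add: \<tau>(2) sum_list_const_mult)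
      finally show "(\<Sum>x\<in>UNIV. S x * pos_sum (h x) a (\<lambda>b. t * \<tau> b)) = 0" .
    qed (simp add: S_def)
    then show ?thesis using \<open>k \<noteq> z\<close> by (simp add: S_def)
  qed
  have \<omega>z: "\<omega> z = 0" using z by (simp add: \<omega>_def)
  show ?thesis
  proof (rule pos_sum_inject[of \<omega>])
    fix x y :: 'x assume "x \<noteq> y"
    then show "\<omega> x > 0 \<or> \<omega> y > 0"
      using normal_to_erased[OF l] by (auto simp: \<omega>_def)
  next
    fix k t
    show "pos_sum (filter (\<lambda>x. x \<noteq> z) (fst E)) k (\<lambda>x. t * \<omega> x) = pos_sum (filter (\<lambda>x. x \<noteq> z) (snd E)) k (\<lambda>x. t * \<omega> x)"
      by (rule pos_sum_extend[OF \<tau>(1)]) (use vanish in \<open>auto simp: pos_sum_filter \<omega>z eq_sum_def\<close>)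
  qed (simp add: \<omega>_def)
qed

section \<open>Minors of two equations\<close>

definition balanced :: "'x equation \<Rightarrow> bool" where
  "balanced E \<longleftrightarrow> count_list (fst E) = count_list (snd E)"

text \<open>If all minors vanish, the sums of the two equations are proportional. Those of
  \<open>E\<close> are not all zero along the length vector of a solution \<open>h\<close> of
  \<open>E\<close>, so \<open>E'\<close> inherits their orthogonality and \<open>h\<close> solves
  \<open>E'\<close>, against independence.\<close>

lemma exists_nonzero_eq_minor:
  fixes E E' :: "('x::finite) equation"
  assumes n: "CARD('x) \<ge> 2" and si: "strongly_independent E E'"
  shows "\<exists>k k' \<theta>. eq_minor E E' k k' \<theta> \<noteq> 0"
proof (rule ccontr)
  assume "\<not> (\<exists>k k' \<theta>. eq_minor E E' k k' \<theta> \<noteq> 0)"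
  then have par: "eq_sum E k \<theta> * eq_sum E' k' \<theta> = eq_sum E k' \<theta> * eq_sum E' k \<theta>" for k k' \<theta>
    by (simp add: eq_minor_def)
  obtain h :: "('x, nat) morph" where h: "is_solution E h" "morph_rank h = CARD('x) - 1" "\<not> is_solution E' h"
    using si by (auto simp: strongly_independent_def)
  obtain l where l: "normal_to h l" using morph_rank_normal[OF h(2) n] by blast
  have E_nontriv: "fst E \<noteq> snd E" using si by (auto simp: strongly_independent_def is_solution_def)
  define \<omega> where "\<omega> = (\<lambda>x. real (length (h x)))"
  have "\<exists>k t. pos_sum (fst E) k (\<lambda>x. t * \<omega> x) \<noteq> pos_sum (snd E) k (\<lambda>x. t * \<omega> x)"
  proof (rule ccontr)
    assume *: "\<not> ?thesis"
    have "fst E = snd E"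
    proof (rule pos_sum_inject[of \<omega>])
      fix x y :: 'x assume "x \<noteq> y"
      then show "\<omega> x > 0 \<or> \<omega> y > 0"
        using normal_to_erased[OF l] by (auto simp: \<omega>_def)
    qed (use * in \<open>auto simp: \<omega>_def\<close>)
    then show False using E_nontriv by simp
  qed
  then obtain k t0 where k: "eq_sum E k (\<lambda>x. t0 * \<omega> x) \<noteq> 0" by (auto simp: eq_sum_def)
  \<comment> \<open>Continuity turns one good parameter into an interval of them, as
    \<open>pos_sum_extend\<close> requires.\<close>
  have "((\<lambda>t. eq_sum E k (\<lambda>x. t * \<omega> x)) \<longlongrightarrow> eq_sum E k (\<lambda>x. t0 * \<omega> x)) (at_right t0)"
    using isCont_eq_sum[where E = E and k = k and w = \<omega> and t = t0] unfolding isCont_def by (rule tendsto_within_subset) simp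
  then have "\<forall>\<^sub>F t in at_right t0. eq_sum E k (\<lambda>x. t * \<omega> x) \<noteq> 0"
    using k by (rule tendsto_imp_eventually_ne)
  then obtain t1 where t1: "t1 > t0" "\<And>t. t0 < t \<Longrightarrow> t < t1 \<Longrightarrow> eq_sum E k (\<lambda>x. t * \<omega> x) \<noteq> 0"
    unfolding eventually_at_right_field by blast
  have \<omega>: "t * \<omega> x = sum_list (map (\<lambda>b. t * 1) (h x))" for t x
    by (simp add: \<omega>_def sum_list_triv mult.commute)
  have eq: "pos_sum (apply_morph h (fst E')) a (\<lambda>b. t * 1) = pos_sum (apply_morph h (snd E')) a (\<lambda>b. t * 1)"
    if t: "t0 < t" "t < t1" for t a
  proof -
    define T where "T = (\<lambda>x. eq_sum E x (\<lambda>x. t * \<omega> x))"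
    define T' where "T' = (\<lambda>x. eq_sum E' x (\<lambda>x. t * \<omega> x))"
    have "T k * (\<Sum>x\<in>UNIV. T' x * pos_sum (h x) a (\<lambda>b. t * 1)) = T' k * (\<Sum>x\<in>UNIV. T x * pos_sum (h x) a (\<lambda>b. t * 1))"
      unfolding sum_distrib_left
    proof (intro sum.cong refl)
      fix x
      have "T k * T' x = T' k * T x" using par[of k _ x] by (simp add: T_def T'_def mult.commute)
      then show "T k * (T' x * pos_sum (h x) a (\<lambda>b. t * 1)) = T' k * (T x * pos_sum (h x) a (\<lambda>b. t * 1))"
        by (metis mult.assoc)
    qed
    also have "(\<Sum>x\<in>UNIV. T x * pos_sum (h x) a (\<lambda>b. t * 1)) = 0"
      unfolding T_def by (rule solution_orth[OF h(1) \<omega>])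
    finally have "(\<Sum>x\<in>UNIV. T' x * pos_sum (h x) a (\<lambda>b. t * 1)) = 0"
      using t1(2)[OF t] by (simp add: T_def)
    moreover have "(\<lambda>x. t * \<omega> x) = (\<lambda>x. sum_list (map (\<lambda>b. t * 1) (h x)))" using \<omega> by auto
    ultimately show ?thesis
      by (simp add: T'_def eq_sum_def pos_sum_apply_morph left_diff_distrib sum_subtractf)
  qed
  have "apply_morph h (fst E') = apply_morph h (snd E')"
    by (rule pos_sum_inject[of "\<lambda>_. 1"]) (simp_all add: pos_sum_extend[OF t1(1) eq, simplified])
  then show False using h(3) by (simp add: is_solution_def)
qed

lemma eq_sum_telescope:
  fixes E :: "('x::finite) equation"
  assumes "balanced E"
  shows "(\<Sum>k\<in>UNIV. eq_sum E k \<theta> * (exp (\<theta> k) - 1)) = 0"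
proof -
  have "sum_list (map \<theta> (fst E)) = sum_list (map \<theta> (snd E))"
    using assms by (simp add: balanced_def sum_list_map_eq_sum_UNIV)
  then show ?thesis
    using pos_sum_telescope[of "fst E" \<theta>] pos_sum_telescope[of "snd E" \<theta>]
    by (simp add: eq_sum_def left_diff_distrib sum_subtractf)
qed

lemma isCont_pos_sum_upd: "isCont (\<lambda>s. pos_sum u k (\<theta>(z := s))) s"
proof (induction u)
  case (Cons c u)
  then show ?case by (cases "c = z") (auto intro!: continuous_intros)
qed simp

text \<open>The relation \<open>eq_sum_telescope\<close> expresses \<open>T\<^sub>z\<close> through the other sums.\<close>

lemma nonzero_eq_minor_avoiding:
  fixes E E' :: "('x::finite) equation"
  assumes bal: "balanced E" "balanced E'" and nz: "eq_minor E E' k0 k0' \<theta>0 \<noteq> 0"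
  shows "\<exists>k k' \<theta>. k \<noteq> z \<and> k' \<noteq> z \<and> eq_minor E E' k k' \<theta> \<noteq> 0"
proof (rule ccontr)
  assume "\<not> ?thesis"
  then have zero: "eq_minor E E' k k' \<theta> = 0" if "k \<noteq> z" "k' \<noteq> z" for k k' \<theta>
    using that by blast
  \<comment> \<open>The relation is solved for coordinate \<open>z\<close> by cancelling
    \<open>exp (\<theta> z) - 1\<close>, hence the condition on \<open>\<theta> z\<close>.\<close>
  have zero_z: "eq_minor E E' z k \<theta> = 0" if "\<theta> z \<noteq> 0" for k \<theta>
  proof (cases "k = z")
    case False
    have split: "eq_sum F z \<theta> * (exp (\<theta> z) - 1) = - (\<Sum>j\<in>UNIV - {z}. eq_sum F j \<theta> * (exp (\<theta> j) - 1))"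
      if "balanced F" for F :: "'x equation"
      using eq_sum_telescope[OF that, of \<theta>] by (simp add: sum.remove[of UNIV z])
    have "eq_minor E E' z k \<theta> * (exp (\<theta> z) - 1)
       = (eq_sum E z \<theta> * (exp (\<theta> z) - 1)) * eq_sum E' k \<theta> - eq_sum E k \<theta> * (eq_sum E' z \<theta> * (exp (\<theta> z) - 1))"
      by (simp add: eq_minor_def algebra_simps)
    also have "\<dots> = - (\<Sum>j\<in>UNIV - {z}. eq_minor E E' j k \<theta> * (exp (\<theta> j) - 1))"
    proof -
      have "(\<Sum>j\<in>UNIV - {z}. eq_sum E j \<theta> * (exp (\<theta> j) - 1)) * eq_sum E' k \<theta>
          - eq_sum E k \<theta> * (\<Sum>j\<in>UNIV - {z}. eq_sum E' j \<theta> * (exp (\<theta> j) - 1))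
          = (\<Sum>j\<in>UNIV - {z}. eq_minor E E' j k \<theta> * (exp (\<theta> j) - 1))"
        unfolding sum_distrib_left sum_distrib_right sum_subtractf[symmetric] eq_minor_def
        by (intro sum.cong) (auto simp: algebra_simps)
      then show ?thesis unfolding split[OF bal(1)] split[OF bal(2)] by simp
    qed
    also have "\<dots> = 0" using zero False by simp
    finally show ?thesis using that by simp
  qed (simp add: eq_minor_def)
  have all: "eq_minor E E' k k' \<theta> = 0" if "\<theta> z \<noteq> 0" for k k' \<theta>
  proof (cases "k = z \<or> k' = z")
    case True
    moreover have "eq_minor E E' k k' \<theta> = - eq_minor E E' k' k \<theta>" by (simp add: eq_minor_def)
    ultimately show ?thesis using zero_z[where \<theta> = \<theta>] that by auto
  next
    case False
    then show ?thesis using zero by blast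
  qed
  \<comment> \<open>Continuity in coordinate \<open>z\<close> moves a nonzero value of the minor to
    a place where this coordinate is not 0.\<close>
  define f where "f = (\<lambda>s. eq_minor E E' k0 k0' (\<theta>0(z := s)))"
  have "isCont f (\<theta>0 z)"
    unfolding f_def eq_minor_def eq_sum_def by (intro continuous_intros isCont_pos_sum_upd)
  then have "f \<midarrow>\<theta>0 z\<rightarrow> f (\<theta>0 z)" by (simp add: isCont_def)
  moreover have "f (\<theta>0 z) \<noteq> 0" using nz by (simp add: f_def)
  ultimately have "\<forall>\<^sub>F s in at (\<theta>0 z). f s \<noteq> 0" by (rule tendsto_imp_eventually_ne)
  moreover have "\<forall>\<^sub>F s in at (\<theta>0 z). s \<noteq> (0::real)" by (rule eventually_neq_at_within)
  ultimately have "\<forall>\<^sub>F s in at (\<theta>0 z). f s \<noteq> 0 \<and> s \<noteq> 0" by eventually_elim simp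
  then obtain s where "f s \<noteq> 0" "s \<noteq> 0"
    using eventually_happens trivial_limit_at by blast
  then show False using all[of "\<theta>0(z := s)"] by (simp add: f_def)
qed

section \<open>Minors as exponential sums over pairs of occurrences\<close>

definition side :: "'x equation \<Rightarrow> bool \<Rightarrow> 'x list" where
  "side E b = (if b then fst E else snd E)"

definition occs :: "'x equation \<Rightarrow> 'x \<Rightarrow> (bool \<times> nat) set" where
  "occs E k = (SIGMA b:UNIV. {j. j < length (side E b) \<and> side E b ! j = k})"

definition parikh :: "'x list \<Rightarrow> real ^ 'x::finite" where
  "parikh u = (\<chi> x. real (count_list u x))"

definition pref :: "'x equation \<Rightarrow> bool \<times> nat \<Rightarrow> real ^ 'x::finite" where
  "pref E = (\<lambda>(b, j). parikh (take j (side E b)))"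

definition sgn_side :: "bool \<times> nat \<Rightarrow> real" where
  "sgn_side p = (if fst p then 1 else - 1)"

lemma finite_occs: "finite (occs E k)"
  by (simp add: occs_def)

lemma card_occs: "card (occs E k) = eq_count E k"
proof -
  have "card {j. j < length u \<and> u ! j = k} = count_list u k" for u :: "'a list"
    by (simp add: count_list_eq_length_filter length_filter_conv_card eq_commute)
  then show ?thesis by (simp add: occs_def card_SigmaI UNIV_bool side_def eq_count_def)
qed

lemma inner_parikh: "(\<chi> x. \<theta> x) \<bullet> parikh u = sum_list (map \<theta> u)"
  by (simp add: inner_vec_def parikh_def sum_list_map_eq_sum_UNIV)

lemma eq_sum_eq_occs:
  fixes E :: "('x::finite) equation"
  shows "eq_sum E k \<theta> = (\<Sum>p\<in>occs E k. sgn_side p * exp ((\<chi> x. \<theta> x) \<bullet> pref E p))"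
  unfolding occs_def
  by (subst sum.Sigma[symmetric, where g = "\<lambda>b j. sgn_side (b, j) * exp ((\<chi> x. \<theta> x) \<bullet> pref E (b, j))", simplified])
     (simp_all add: UNIV_bool sgn_side_def pref_def inner_parikh eq_sum_def pos_sum_eq_sum side_def sum_negf)

lemma eq_minor_hyperplane_count:
  fixes E E' :: "('x::finite) equation" and l \<omega> :: "'j \<Rightarrow> 'x \<Rightarrow> real"
  assumes nz: "eq_minor E E' k k' \<theta> \<noteq> 0" and "finite I"
    and l0: "\<And>i. i \<in> I \<Longrightarrow> \<exists>x. l i x \<noteq> 0"
    and lpar: "\<And>i j c. i \<in> I \<Longrightarrow> j \<in> I \<Longrightarrow> i \<noteq> j \<Longrightarrow> \<exists>x. l j x \<noteq> c * l i x"
    and \<omega>0: "\<And>i x. \<omega> i x \<ge> 0"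
    and \<omega>: "\<And>i. i \<in> I \<Longrightarrow> \<omega> i k > 0" "\<And>i. i \<in> I \<Longrightarrow> \<omega> i k' > 0"
      "\<And>i. i \<in> I \<Longrightarrow> (\<Sum>x\<in>UNIV. \<omega> i x * l i x) = 0"
    and vanish: "\<And>i w. i \<in> I \<Longrightarrow> (\<Sum>x\<in>UNIV. w x * l i x) = 0 \<Longrightarrow>
        \<exists>\<delta>>0. \<forall>t. 0 < t \<and> t < \<delta> \<longrightarrow> eq_minor E E' k k' (\<lambda>x. t * w x) = 0"
  shows "card I + 1 \<le> 2 * (eq_count E k + eq_count E k')"
proof -
  define X where "X = {True} \<times> (occs E k \<times> occs E' k') \<union> {False} \<times> (occs E k' \<times> occs E' k)"
  define e where "e = (\<lambda>(c::bool, p, q). pref E p + pref E' q)"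
  define s where "s = (\<lambda>(c::bool, p, q). (if c then 1 else - 1) * sgn_side p * sgn_side q)"
  \<comment> \<open>Only the position in \<open>E'\<close> is forgotten. The first Boolean tells the
    two products of the minor apart, and \<open>fst q\<close> is the side of
    \<open>E'\<close>.\<close>
  define cls where "cls = (\<lambda>(c::bool, p::bool \<times> nat, q::bool \<times> nat). (c, p, fst q))"
  define K where "K = {True} \<times> (occs E k \<times> (UNIV :: bool set)) \<union> {False} \<times> (occs E k' \<times> UNIV)"
  have minor: "eq_minor E E' k k' \<theta> = (\<Sum>x\<in>X. s x * exp ((\<chi> x. \<theta> x) \<bullet> e x))" for \<theta>
  proof -
    have prod: "eq_sum E a \<theta> * eq_sum E' b \<theta> = (\<Sum>(p, q)\<in>occs E a \<times> occs E' b.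
        sgn_side p * sgn_side q * exp ((\<chi> x. \<theta> x) \<bullet> (pref E p + pref E' q)))" for a b
      unfolding eq_sum_eq_occs sum_product sum.cartesian_product
      by (intro sum.cong) (auto simp: inner_add_right exp_add)
    have "(\<Sum>x\<in>X. s x * exp ((\<chi> x. \<theta> x) \<bullet> e x))
      = (\<Sum>x\<in>{True} \<times> (occs E k \<times> occs E' k'). s x * exp ((\<chi> x. \<theta> x) \<bullet> e x))
      + (\<Sum>x\<in>{False} \<times> (occs E k' \<times> occs E' k). s x * exp ((\<chi> x. \<theta> x) \<bullet> e x))"
      unfolding X_def by (intro sum.union_disjoint) (auto simp: finite_occs)
    also have "\<dots> = eq_minor E E' k k' \<theta>"
      unfolding eq_minor_def prod sum.cartesian_product'
      by (simp add: s_def e_def case_prod_unfold sum_negf)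
    finally show ?thesis by simp
  qed
  \<comment> \<open>Increments from a prefix of a side of \<open>E'\<close> that precedes
    \<open>k\<close> or \<open>k'\<close> to a longer one; the weights in \<open>C\<close> make
    every chain increase with the position.\<close>
  define \<Delta> where "\<Delta> = {parikh (take j (side E' b)) - parikh (take i (side E' b)) | b i j.
      i < j \<and> j < length (side E' b) \<and> side E' b ! i \<in> {k, k'}}"
  define C where "C = {w. \<forall>d\<in>\<Delta>. w \<bullet> d > 0}"
  have "\<Delta> \<subseteq> (\<Union>b. (\<lambda>(i, j). parikh (take j (side E' b)) - parikh (take i (side E' b))) `
      ({..<length (side E' b)} \<times> {..<length (side E' b)}))"
    by (force simp: \<Delta>_def)
  then have f\<Delta>: "finite \<Delta>" by (rule finite_subset) auto
  have C_eq: "C = (\<Inter>d\<in>\<Delta>. {w. d \<bullet> w > 0})" by (auto simp: C_def inner_commute)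
  have oC: "open C"
    unfolding C_eq using f\<Delta> by (intro open_INT ballI open_halfspace_gt)
  have cC: "convex C" unfolding C_eq by (intro convex_INT convex_halfspace_gt)
  \<comment> \<open>An increment starts with \<open>k\<close> or \<open>k'\<close>. Weight 0
    elsewhere is allowed, so that solutions erasing a third unknown still meet the cone.\<close>
  have memC: "(\<chi> x. w x) \<in> C" if w: "\<And>x. w x \<ge> 0" "w k > 0" "w k' > 0" for w
  proof -
    have "(\<chi> x. w x) \<bullet> (parikh (take j u) - parikh (take i u)) > 0"
      if "i < j" "j < length u" "u ! i \<in> {k, k'}" for i j u
    proof -
      have "take j u = take i u @ u ! i # take (j - Suc i) (drop (Suc i) u)"
        using that by (metis Cons_nth_drop_Suc Suc_diff_Suc le_add_diff_inverse less_imp_le less_trans take_Suc_Cons take_add)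
      moreover have "sum_list (map w v) \<ge> 0" for v using w(1) by (intro sum_list_nonneg) auto
      moreover have "w (u ! i) > 0" using that w by auto
      ultimately show ?thesis by (simp add: inner_diff_right inner_parikh add_pos_nonneg)
    qed
    then show ?thesis by (auto simp: C_def \<Delta>_def)
  qed
  have "card I + 1 \<le> card K"
  proof (rule exponential_sum_hyperplane_count[where e = e and s = s and cls = cls and C = C
        and l = "\<lambda>i. \<chi> x. l i x" and \<theta> = "\<chi> x. \<theta> x"])
    show "finite X" "finite K" by (auto simp: X_def K_def finite_occs)
    show "cls ` X \<subseteq> K" by (auto simp: X_def K_def cls_def)
    show "C \<noteq> {}" using memC[of "\<lambda>_. 1"] by auto
    show "(\<Sum>x\<in>X. s x * exp ((\<chi> x. \<theta> x) \<bullet> e x)) \<noteq> 0" using nz minor by simp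
  next
    fix x y assume x: "x \<in> X" and y: "y \<in> X" and eq: "cls x = cls y" and ne: "e x \<noteq> e y"
    obtain c p b i j where xy: "x = (c, p, b, i)" "y = (c, p, b, j)"
      using eq by (cases x, cases y) (auto simp: cls_def)
    have lt: "\<forall>w\<in>C. w \<bullet> e (c, p, b, i) < w \<bullet> e (c, p, b, j)"
      if "(c, p, b, i) \<in> X" "(c, p, b, j) \<in> X" "i < j" for i j
    proof -
      have "parikh (take j (side E' b)) - parikh (take i (side E' b)) \<in> \<Delta>"
        using that by (auto simp: \<Delta>_def X_def occs_def)
      then show ?thesis by (auto simp: C_def e_def pref_def inner_diff_right inner_add_right)
    qed
    have "i \<noteq> j" using ne xy by auto
    then show "(\<forall>w\<in>C. w \<bullet> e x < w \<bullet> e y) \<or> (\<forall>w\<in>C. w \<bullet> e y < w \<bullet> e x)"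
      using lt[of i j] lt[of j i] x y xy by (cases i j rule: linorder_cases) auto
  next
    fix i assume "i \<in> I"
    then show "(\<chi> x. l i x) \<noteq> 0" using l0 by (auto simp: vec_eq_iff)
    show "\<exists>w\<in>C. (\<chi> x. l i x) \<bullet> w = 0"
      using \<open>i \<in> I\<close> memC[of "\<omega> i"] \<omega> \<omega>0
      by (intro bexI[of _ "\<chi> x. \<omega> i x"]) (auto simp: inner_vec_def mult.commute)
  next
    fix i j c assume "i \<in> I" "j \<in> I" "i \<noteq> j"
    then show "(\<chi> x. l j x) \<noteq> c *\<^sub>R (\<chi> x. l i x)" using lpar[of i j c] by (auto simp: vec_eq_iff)
  next
    fix i w assume "i \<in> I" "w \<in> C" "(\<chi> x. l i x) \<bullet> w = 0"
    then have "(\<Sum>x\<in>UNIV. w $ x * l i x) = 0" by (simp add: inner_vec_def mult.commute)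
    then obtain \<delta> where \<delta>: "\<delta> > 0" "\<And>t. 0 < t \<Longrightarrow> t < \<delta> \<Longrightarrow> eq_minor E E' k k' (\<lambda>x. t * w $ x) = 0"
      using vanish[OF \<open>i \<in> I\<close>] by blast
    have "(\<chi> x. t * w $ x) = t *\<^sub>R w" for t by (simp add: vec_eq_iff)
    then show "\<exists>\<delta>>0. \<forall>t. 0 < t \<and> t < \<delta> \<longrightarrow> (\<Sum>x\<in>X. s x * exp (t * (w \<bullet> e x))) = 0"
      using \<delta> by (intro exI[of _ \<delta>]) (auto simp: minor)
  qed (use assms oC cC in auto)
  also have "card K = 2 * (eq_count E k + eq_count E k')"
    unfolding K_def by (subst card_Un_disjoint) (auto simp: finite_occs card_cartesian_product card_occs)
  finally show ?thesis .
qed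

section \<open>Counting the common solutions\<close>

lemma lin_equiv_if_normal_parallel:
  assumes l: "normal_to h l" "normal_to h' l'"
    and c: "\<And>x. real_of_rat (l' x) = c * real_of_rat (l x)"
  shows "lin_equiv h h'"
proof -
  have "c \<noteq> 0" using l(2) c by (auto simp: normal_to_def)
  have "(\<Sum>x\<in>UNIV. v x * l' x) = 0 \<longleftrightarrow> (\<Sum>x\<in>UNIV. v x * l x) = 0" for v
  proof -
    have "real_of_rat (\<Sum>x\<in>UNIV. v x * l' x) = c * real_of_rat (\<Sum>x\<in>UNIV. v x * l x)"
      by (simp add: of_rat_sum of_rat_mult c sum_distrib_left mult.left_commute)
    then show ?thesis using \<open>c \<noteq> 0\<close> by (metis mult_eq_0_iff of_rat_eq_0_iff)
  qed
  then show ?thesis using l by (simp add: lin_equiv_def normal_to_def)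
qed

text \<open>At \<theta> = 0 the sums in \<open>solution_orth\<close> are letter counts. So the count
  difference is orthogonal to the hyperplane and hence parallel to \<open>l\<close>.\<close>

lemma normal_to_count_diff:
  fixes E :: "('x::finite) equation"
  assumes l: "normal_to h l" and sol: "is_solution E h"
  defines "\<delta> \<equiv> \<lambda>x. real (count_list (fst E) x) - real (count_list (snd E) x)"
  shows "\<delta> j * real_of_rat (l i) = \<delta> i * real_of_rat (l j)"
proof -
  obtain F c where F: "\<And>x. kink (\<lambda>x. real_of_rat (l x)) i j x = (\<Sum>a\<in>F. c a * real (count_list (h x) a))"
    using normal_to_comb[OF l] by blast
  have orth: "(\<Sum>x\<in>UNIV. \<delta> x * real (count_list (h x) a)) = 0" for a
    using solution_orth[OF sol, of "\<lambda>_. 0" "\<lambda>_. 0" a] by (simp add: eq_sum_def pos_sum_zero \<delta>_def)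
  have "(\<Sum>x\<in>UNIV. \<delta> x * kink (\<lambda>x. real_of_rat (l x)) i j x)
      = (\<Sum>a\<in>F. c a * (\<Sum>x\<in>UNIV. \<delta> x * real (count_list (h x) a)))"
    unfolding F sum_distrib_left by (subst sum.swap) (simp add: mult.left_commute)
  then show ?thesis by (simp add: sum_kink orth)
qed

text \<open>A nonzero count difference would be normal to both hyperplanes, which would then
  coincide.\<close>

lemma balanced_if_not_lin_equiv:
  fixes E :: "('x::finite) equation"
  assumes l: "normal_to h l" "normal_to h' l'" and sol: "is_solution E h" "is_solution E h'"
    and ne: "\<not> lin_equiv h h'"
  shows "balanced E"
proof (rule ccontr)
  define \<delta> where "\<delta> = (\<lambda>x. real (count_list (fst E) x) - real (count_list (snd E) x))"
  assume "\<not> balanced E"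
  then obtain i where i: "\<delta> i \<noteq> 0" by (auto simp: balanced_def \<delta>_def fun_eq_iff)
  have *: "\<delta> j * real_of_rat (l i) = \<delta> i * real_of_rat (l j)"
    "\<delta> j * real_of_rat (l' i) = \<delta> i * real_of_rat (l' j)" for j
    using normal_to_count_diff[OF l(1) sol(1)] normal_to_count_diff[OF l(2) sol(2)] by (simp_all add: \<delta>_def)
  have li: "l i \<noteq> 0"
  proof
    assume "l i = 0"
    then have "l j = 0" for j using *(1)[of j] i by simp
    then show False using l(1) by (simp add: normal_to_def)
  qed
  have "real_of_rat (l' x) = real_of_rat (l' i) / real_of_rat (l i) * real_of_rat (l x)" for x
  proof -
    have "\<delta> i * (real_of_rat (l' x) * real_of_rat (l i)) = \<delta> i * (real_of_rat (l' i) * real_of_rat (l x))"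
      using *[of x] by (metis mult.assoc mult.commute)
    then show ?thesis using i li by (simp add: field_simps)
  qed
  then show False using lin_equiv_if_normal_parallel[OF l] ne by blast
qed

text \<open>The deletion must destroy the first mismatch. So it concerns one of the two letters
  there or, if one word is a prefix of the other, the first additional letter.\<close>

lemma filter_neq_eq_letters:
  assumes "u \<noteq> v"
  shows "\<exists>x y. \<forall>z. filter (\<lambda>a. a \<noteq> z) u = filter (\<lambda>a. a \<noteq> z) v \<longrightarrow> z = x \<or> z = y"
  using assms
proof (induction u v rule: list_induct2')
  case (2 x xs)
  then show ?case by (intro exI[of _ x]) auto
next
  case (3 y ys)
  then show ?case by (intro exI[of _ y]) auto
next
  case (4 x xs y ys)
  show ?case
  proof (cases "x = y")
    case True
    then obtain x' y' where "\<forall>z. filter (\<lambda>a. a \<noteq> z) xs = filter (\<lambda>a. a \<noteq> z) ys \<longrightarrow> z = x' \<or> z = y'"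
      using 4 by blast
    then show ?thesis using True by (intro exI[of _ x'] exI[of _ y']) auto
  next
    case False
    then show ?thesis by (intro exI[of _ x] exI[of _ y]) auto
  qed
qed simp

lemma sum_eq_count: "(\<Sum>x\<in>UNIV. eq_count E x) = eq_length E" for E :: "('x::finite) equation"
  using sum_count_set[of "fst E" UNIV] sum_count_set[of "snd E" UNIV]
  by (simp add: eq_count_def eq_length_def sum.distrib)

lemma eq_count_pair_le_length:
  fixes E :: "('x::finite) equation"
  assumes "k \<noteq> k'"
  shows "eq_count E k + eq_count E k' \<le> eq_length E"
proof -
  have "(\<Sum>x\<in>{k, k'}. eq_count E x) \<le> (\<Sum>x\<in>UNIV. eq_count E x)"
    by (intro sum_mono2) auto
  then show ?thesis using assms by (simp add: sum_eq_count)
qed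

text \<open>One pair of unknowns serves both equations, so that the two bounds can be added. With
  \<open>m \<ge> 2\<close> there are two nonequivalent solutions, which makes both equations
  balanced.\<close>

lemma common_solutions_bound:
  fixes E E' :: "('x::finite) equation" and hs :: "nat \<Rightarrow> ('x, 'a) morph"
  assumes "card (UNIV :: 'x set) \<ge> 2"
    and "strongly_independent E E'"
    and sol: "\<And>i. i < m \<Longrightarrow> is_solution E (hs i)" "\<And>i. i < m \<Longrightarrow> is_solution E' (hs i)"
    and rk: "\<And>i. i < m \<Longrightarrow> morph_rank (hs i) = card (UNIV :: 'x set) - 1"
    and ne: "\<And>i j. i < m \<Longrightarrow> j < m \<Longrightarrow> i \<noteq> j \<Longrightarrow> \<not> lin_equiv (hs i) (hs j)"
    and "m \<ge> 2"
  shows "\<exists>k k'. k \<noteq> k' \<and> m \<le> 2 * (eq_count E k + eq_count E k') \<and> m \<le> 2 * (eq_count E' k + eq_count E' k')"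
proof -
  have "\<forall>i. \<exists>l. i < m \<longrightarrow> normal_to (hs i) l"
    using morph_rank_normal[OF rk] assms(1) by blast
  then obtain l where l: "\<And>i. i < m \<Longrightarrow> normal_to (hs i) (l i)" by metis
  have lpar: "\<exists>x. real_of_rat (l j x) \<noteq> c * real_of_rat (l i x)" if "i < m" "j < m" "i \<noteq> j" for i j c
    using lin_equiv_if_normal_parallel[OF l l, of i j c] ne that by blast
  have bal: "balanced E" "balanced E'"
    using balanced_if_not_lin_equiv[OF l l sol(1) sol(1), of 0 1] balanced_if_not_lin_equiv[OF l l sol(2) sol(2), of 0 1]
      ne[of 0 1] \<open>m \<ge> 2\<close> by auto
  define Z where "Z = {z. \<exists>i<m. hs i z = []}"
  have E_nontriv: "fst E \<noteq> snd E" using assms(2) by (auto simp: strongly_independent_def is_solution_def)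
  obtain x y where "\<And>z. filter (\<lambda>a. a \<noteq> z) (fst E) = filter (\<lambda>a. a \<noteq> z) (snd E) \<Longrightarrow> z = x \<or> z = y"
    using filter_neq_eq_letters[OF E_nontriv] by blast
  then have Zxy: "Z \<subseteq> {x, y}" using erased_filter_eq[OF l sol(1)] by (auto simp: Z_def)
  obtain k0 k0' \<theta>0 where nz0: "eq_minor E E' k0 k0' \<theta>0 \<noteq> 0"
    using exists_nonzero_eq_minor[OF assms(1,2)] by blast
  \<comment> \<open>\<open>Z\<close> has at most two elements; if it has an element
    \<open>z\<close>, a nonzero minor avoiding \<open>z\<close> leaves at most one of them in
    \<open>{k, k'}\<close>.\<close>
  obtain k k' \<theta> where nz: "eq_minor E E' k k' \<theta> \<noteq> 0" and Zk: "card (Z \<inter> {k, k'}) \<le> 1"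
  proof (cases "Z = {}")
    case True
    then show ?thesis using that nz0 by fastforce
  next
    case False
    then obtain z where z: "z \<in> Z" by blast
    obtain k k' \<theta> where k: "k \<noteq> z" "k' \<noteq> z" "eq_minor E E' k k' \<theta> \<noteq> 0"
      using nonzero_eq_minor_avoiding[OF bal nz0, of z] by blast
    have "Z \<inter> {k, k'} \<subseteq> {x, y} - {z}" using Zxy k by auto
    then have "card (Z \<inter> {k, k'}) \<le> card ({x, y} - {z})" by (intro card_mono) auto
    also have "\<dots> \<le> 1" using z Zxy by (auto simp: card_insert_if insert_Diff_if)
    finally show ?thesis using that k by blast
  qed
  have kk': "k \<noteq> k'" using nz by (auto simp: eq_minor_def)
  define I where "I = {i. i < m \<and> hs i k \<noteq> [] \<and> hs i k' \<noteq> []}"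
  \<comment> \<open>Solutions that erase the same unknown have the same hyperplane, so at most one
    index is lost.\<close>
  have mI: "m \<le> card I + 1"
  proof -
    define g where "g = (\<lambda>i. if hs i k = [] then k else k')"
    have "inj_on g ({..<m} - I)"
    proof (rule inj_onI)
      fix i j assume ij: "i \<in> {..<m} - I" "j \<in> {..<m} - I" "g i = g j"
      then have e: "hs i (g i) = []" "hs j (g i) = []" by (auto simp: I_def g_def split: if_splits)
      have lt: "i < m" "j < m" using ij by auto
      have "real_of_rat (l j x) = real_of_rat (l j (g i)) / real_of_rat (l i (g i)) * real_of_rat (l i x)" for x
        using normal_to_erased(1)[OF l[OF lt(1)] e(1)] normal_to_erased(2)[OF l[OF lt(1)] e(1), of x]
          normal_to_erased(2)[OF l[OF lt(2)] e(2), of x]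
        by (cases "x = g i") auto
      then show "i = j" using lpar[OF lt] by blast
    qed
    moreover have "g ` ({..<m} - I) \<subseteq> Z \<inter> {k, k'}" by (auto simp: g_def I_def Z_def)
    ultimately have "card ({..<m} - I) \<le> card (Z \<inter> {k, k'})" by (rule card_inj_on_le) simp
    moreover have "card ({..<m} - I) = m - card I"
      by (subst card_Diff_subset) (auto simp: I_def)
    ultimately show ?thesis using Zk by simp
  qed
  have count: "card I + 1 \<le> 2 * (eq_count F k + eq_count F k')"
    if F: "eq_minor F F' k k' \<theta> \<noteq> 0" "\<And>i. i < m \<Longrightarrow> is_solution F (hs i)" "\<And>i. i < m \<Longrightarrow> is_solution F' (hs i)"
    for F F' :: "'x equation"
  proof (rule eq_minor_hyperplane_count[where l = "\<lambda>i x. real_of_rat (l i x)" and \<omega> = "\<lambda>i x. real (length (hs i x))"])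
    show "eq_minor F F' k k' \<theta> \<noteq> 0" by (rule F)
    show "finite I" by (simp add: I_def)
  next
    fix i assume i: "i \<in> I"
    then have "i < m" by (simp add: I_def)
    then show "\<exists>x. real_of_rat (l i x) \<noteq> 0" using l[of i] by (simp add: normal_to_def)
    show "(\<Sum>x\<in>UNIV. real (length (hs i x)) * real_of_rat (l i x)) = 0"
      by (rule normal_to_lengths[OF l[OF \<open>i < m\<close>]])
    show "\<exists>\<delta>>0. \<forall>t. 0 < t \<and> t < \<delta> \<longrightarrow> eq_minor F F' k k' (\<lambda>x. t * w x) = 0"
      if "(\<Sum>x\<in>UNIV. w x * real_of_rat (l i x)) = 0" for w
      using eq_minor_vanish[OF l F(2) F(3) that] \<open>i < m\<close> by blast
  qed (use lpar in \<open>auto simp: I_def\<close>)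
  have nz': "eq_minor E' E k k' \<theta> \<noteq> 0" using nz by (simp add: eq_minor_def mult.commute)
  show ?thesis
    using kk' mI count[OF nz sol] count[OF nz' sol(2) sol(1)] by (intro exI[of _ k] exI[of _ k']) simp
qed

theorem theorem4p5:
  fixes E E' :: "('x::finite) equation"
    and hs :: "nat \<Rightarrow> ('x, 'a) morph"
    and m :: nat
  assumes "card (UNIV :: 'x set) \<ge> 2"
    and "strongly_independent E E'"
    and "\<forall>i<m. is_solution E (hs i) \<and> is_solution E' (hs i) \<and> morph_rank (hs i) = card (UNIV :: 'x set) - 1"
    and "\<forall>i<m. \<forall>j<m. i \<noteq> j \<longrightarrow> \<not> lin_equiv (hs i) (hs j)"
  shows "m \<le> eq_length E + eq_length E'
         \<and> (\<exists>k l. k \<noteq> l \<and> m \<le> 2 * (eq_count E k + eq_count E l))"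
proof (cases "m \<ge> 2")
  case True
  obtain k k' where k: "k \<noteq> k'" "m \<le> 2 * (eq_count E k + eq_count E k')" "m \<le> 2 * (eq_count E' k + eq_count E' k')"
  proof -
    have "is_solution E (hs i)" "is_solution E' (hs i)" "morph_rank (hs i) = CARD('x) - 1" if "i < m" for i
      using assms(3) that by auto
    moreover have "\<not> lin_equiv (hs i) (hs j)" if "i < m" "j < m" "i \<noteq> j" for i j
      using assms(4) that by blast
    ultimately show ?thesis
      using common_solutions_bound[OF assms(1,2) _ _ _ _ True, of hs] that by blast
  qed
  then show ?thesis
    using eq_count_pair_le_length[of k k' E] eq_count_pair_le_length[of k k' E'] by (intro conjI exI[of _ k] exI[of _ k']) auto
next
  case False
  \<comment> \<open>For \<open>m\<close> at most 1 a single occurrence of an unknown in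
    \<open>E\<close> is enough, and \<open>E\<close> has one, being nontrivial.\<close>
  have "fst E \<noteq> snd E" using assms(2) by (auto simp: strongly_independent_def is_solution_def)
  then have "eq_length E \<noteq> 0" by (auto simp: eq_length_def)
  then have "(\<Sum>k\<in>UNIV. eq_count E k) \<noteq> 0" by (simp only: sum_eq_count not_False_eq_True)
  then obtain k where k: "eq_count E k \<noteq> 0" by (rule sum.not_neutral_contains_not_neutral)
  have "UNIV \<noteq> {k}"
  proof
    assume "UNIV = {k}"
    then have "card (UNIV :: 'x set) = card {k}" by (rule arg_cong)
    then show False using assms(1) by simp
  qed
  then obtain k' where "k' \<noteq> k" by blast
  then show ?thesis using k False \<open>eq_length E \<noteq> 0\<close> by (intro conjI exI[of _ k] exI[of _ k']) auto
qed

end
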